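(* Let $X$ be a locally convex Hausdorff real topological vector space and let $(f_i)_{i\in I}\subset\Gamma(X)$ be such that the system $(\mathrm S)$: $\{f_i(x)\le 0,\ i\in I\}$ is inconsistent (has no solution $x\in X$). Assume that the robust sum $\sum_{i\in I}^{R}f_i$ is proper and weakly inf-locally compact, and that $\overline{\operatorname{cone}}\,\operatorname{co}\Big(\bigcup_{J\in\mathcal F(I)}\sum_{j\in J}\operatorname{dom}f_j^*\Big)$ is a linear subspace of $X^*$. Then the set $\ell_1\text{-}\operatorname{sol}(\mathrm S)$ of minimizers over $X$ of $x\mapsto\sum_{i\in I}f_i^+(x)$ is the sum of a nonempty convex weakly compact set and a finite-dimensional linear subspace of $X$. Moreover, one has $$\inf_{x\in X}\sum_{i\in I}f_i^+(x)=\max\Big\{-\sum_{j\in J}f_j^*(x_j^* ):J\in\mathcal F(I),\ (x_j^* )_{j\in J}\in(X^* )^J,\ \sum_{j\in J}x_j^*=0_{X^*}\Big\}$$ (equality of values with the maximum attained) if and only if $$\bigcup_{J\in\mathcal F(I)}\sum_{j\in J}\operatorname{epi}f_j^*\ \text{ is } w^*\text{-closed convex regarding }\{0_{X^*}\}\times\mathbb R.$$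
   Context: $X^*$ is the topological dual of $X$, equipped with the weak$^*$ topology ($X^*\times\mathbb R$ with the product topology). $I$ is an infinite index set and $\mathcal F(I)$ is the collection of all nonempty finite subsets of $I$. The robust sum is $\sum_{i\in I}^R f_i(x):=\sup_{J\in\mathcal F(I)}\sum_{i\in J}f_i(x)$. $f_i^+=\max\{f_i,0\}$, and $\sum_{i\in I}f_i^+(x)$ is the (possibly infinite) limit of the net of finite partial sums indexed by $\mathcal F(I)$ directed by inclusion, i.e. the supremum of the finite partial sums. $\Gamma(X)$ is the set of proper lower semicontinuous convex functions $X\to\mathbb R\cup\{+\infty\}$. $f_j^*(x^* )=\sup_{x\in X}\{\langle x^*,x\rangle-f_j(x)\}$; $\operatorname{dom}$ denotes the set where a function is $<+\infty$; $\operatorname{epi}f_j^*=\{(x^*,r)\in X^*\times\mathbb R:f_j^*(x^* )\le r\}$. A function $f$ is weakly inf-locally compact if each lower level set $\{x:f(x)\le r\}$, $r\in\mathbb R$, is weakly locally compact. $\operatorname{co}A$ is the convex hull; $\operatorname{cone}A$ is the cone generated by $A\cup\{0\}$, i.e. $\{ta:t\ge0,\ a\in A\}$ for $A\ne\emptyset$, and $\overline{\operatorname{cone}}A$ its weak$^*$ closure. A set $C$ is $w^*$-closed convex regarding a set $B$ if $B\cap\overline{\operatorname{co}}\,C=B\cap C$, where $\overline{\operatorname{co}}\,C$ is the ($w^*$-)closed convex hull of $C$. Sums of sets are Minkowski sums. *)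

theory Defs
  imports "HOL-Analysis.Analysis" "HOL-Library.Set_Algebras"
begin

section \<open>Locally convex Hausdorff real topological vector spaces\<close>

class lctvs = topological_ab_group_add + real_vector + t2_space +
  assumes tendsto_scaleR_prod:
    "((\<lambda>p. fst p *\<^sub>R snd p) \<longlongrightarrow> c *\<^sub>R x) (nhds c \<times>\<^sub>F nhds x)"
  \<comment> \<open>the definition of \<^const>\<open>convex\<close> is unfolded: the constant cannot occur in a class specification\<close>
  assumes locally_convex_raw:
    "\<lbrakk>open U; 0 \<in> U\<rbrakk> \<Longrightarrow> \<exists>V. open V \<and> 0 \<in> V \<and> V \<subseteq> U \<and>
       (\<forall>x\<in>V. \<forall>y\<in>V. \<forall>u\<ge>0. \<forall>v\<ge>0. u + v = 1 \<longrightarrow> u *\<^sub>R x + v *\<^sub>R y \<in> V)"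

lemma locally_convex:
  fixes U :: "'a::lctvs set"
  assumes "open U" "0 \<in> U"
  shows "\<exists>V. open V \<and> convex V \<and> 0 \<in> V \<and> V \<subseteq> U"
  using locally_convex_raw[OF assms] unfolding convex_def by blast

instance real_normed_vector \<subseteq> lctvs
proof
  fix c :: real and x :: 'a
  show "((\<lambda>p. fst p *\<^sub>R snd p) \<longlongrightarrow> c *\<^sub>R x) (nhds c \<times>\<^sub>F nhds x)"
    by (intro tendsto_scaleR filterlim_fst filterlim_snd)
next
  fix U :: "'a set"
  assume "open U" "0 \<in> U"
  then obtain e where "e > 0" "ball 0 e \<subseteq> U"
    by (meson open_contains_ball)
  then show "\<exists>V. open V \<and> 0 \<in> V \<and> V \<subseteq> U \<and>
       (\<forall>x\<in>V. \<forall>y\<in>V. \<forall>u\<ge>0. \<forall>v\<ge>0. u + v = 1 \<longrightarrow> u *\<^sub>R x + v *\<^sub>R y \<in> V)"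
    using convex_ball[of "0::'a" e, unfolded convex_def]
    by (intro exI[of _ "ball 0 e"]) simp
qed

section \<open>The topological dual with its weak* topology\<close>

typedef (overloaded) 'a dual =
  "{\<phi> :: 'a::lctvs \<Rightarrow> real. linear \<phi> \<and> continuous_on UNIV \<phi>}"
  morphisms dual_apply Dual
  by (rule exI[of _ "\<lambda>x. 0"]) (auto intro: linear_zero)

setup_lifting type_definition_dual

instantiation dual :: (lctvs) real_vector
begin

lift_definition zero_dual :: "'a dual" is "\<lambda>x. 0"
  by (auto intro: linear_zero)

lift_definition plus_dual :: "'a dual \<Rightarrow> 'a dual \<Rightarrow> 'a dual" is "\<lambda>\<phi> \<psi> x. \<phi> x + \<psi> x"
  by (auto intro: linear_compose_add continuous_on_add)

lift_definition uminus_dual :: "'a dual \<Rightarrow> 'a dual" is "\<lambda>\<phi> x. - \<phi> x"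
  by (auto intro: linear_compose_neg continuous_on_minus)

lift_definition minus_dual :: "'a dual \<Rightarrow> 'a dual \<Rightarrow> 'a dual" is "\<lambda>\<phi> \<psi> x. \<phi> x - \<psi> x"
  by (auto intro: linear_compose_sub continuous_on_diff)

lift_definition scaleR_dual :: "real \<Rightarrow> 'a dual \<Rightarrow> 'a dual" is "\<lambda>c \<phi> x. c * \<phi> x"
  using linear_compose_scale_right[where 'b = real] continuous_on_mult_left by fastforce

instance
  by standard (transfer; auto simp: algebra_simps)+

end

text \<open>The \<^const>\<open>euclidean\<close> topology on a function type is the product topology.  Pulled back
  along evaluation it yields the weak* topology on the dual; \<^typ>\<open>'a dual \<times> real\<close> then carries
  the product topology by the library instance.\<close>

instantiation dual :: (lctvs) topological_space
begin

definition open_dual :: "'a dual set \<Rightarrow> bool" where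
  "open_dual = openin (pullback_topology UNIV dual_apply euclidean)"

instance
proof
  show "open (UNIV :: 'a dual set)"
    unfolding open_dual_def
    using openin_topspace[of "pullback_topology UNIV (dual_apply :: 'a dual \<Rightarrow> _) euclidean"]
    by (simp add: topspace_pullback_topology)
qed (auto simp: open_dual_def)

end

definition weak_topology :: "'a::lctvs topology" where
  "weak_topology = pullback_topology UNIV (\<lambda>x \<phi>. dual_apply \<phi> x) euclidean"

section \<open>Extended real-valued functions\<close>

definition proper :: "('a \<Rightarrow> ereal) \<Rightarrow> bool" where
  "proper f \<longleftrightarrow> (\<forall>x. f x \<noteq> -\<infinity>) \<and> (\<exists>x. f x \<noteq> \<infinity>)"

definition lsc :: "('a::topological_space \<Rightarrow> ereal) \<Rightarrow> bool" where
  "lsc f \<longleftrightarrow> (\<forall>x a. a < f x \<longrightarrow> (\<forall>\<^sub>F y in nhds x. a < f y))"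

definition convex_fun :: "('a::real_vector \<Rightarrow> ereal) \<Rightarrow> bool" where
  "convex_fun f \<longleftrightarrow> (\<forall>x y t. 0 < t \<and> t < 1 \<longrightarrow>
     f ((1 - t) *\<^sub>R x + t *\<^sub>R y) \<le> ereal (1 - t) * f x + ereal t * f y)"

definition proper_lsc_convex :: "('a::lctvs \<Rightarrow> ereal) set" where
  "proper_lsc_convex = {f. proper f \<and> lsc f \<and> convex_fun f}"

definition eff_dom :: "('a \<Rightarrow> ereal) \<Rightarrow> 'a set" where
  "eff_dom f = {x. f x < \<infinity>}"

definition epi :: "('a \<Rightarrow> ereal) \<Rightarrow> ('a \<times> real) set" where
  "epi f = {(x, r). f x \<le> ereal r}"

definition conjugate :: "('a::lctvs \<Rightarrow> ereal) \<Rightarrow> 'a dual \<Rightarrow> ereal" where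
  "conjugate f \<phi> = (SUP x. ereal (dual_apply \<phi> x) - f x)"

definition weakly_inf_locally_compact :: "('a::lctvs \<Rightarrow> ereal) \<Rightarrow> bool" where
  "weakly_inf_locally_compact f \<longleftrightarrow>
     (\<forall>r::real. locally_compact_space (subtopology weak_topology {x. f x \<le> ereal r}))"

section \<open>Families of functions\<close>

definition fin_subsets :: "'i set \<Rightarrow> 'i set set" where
  "fin_subsets I = {J. J \<subseteq> I \<and> finite J \<and> J \<noteq> {}}"

definition robust_sum :: "'i set \<Rightarrow> ('i \<Rightarrow> 'a \<Rightarrow> ereal) \<Rightarrow> 'a \<Rightarrow> ereal" where
  "robust_sum I f x = (SUP J\<in>fin_subsets I. \<Sum>i\<in>J. f i x)"

definition pos_sum :: "'i set \<Rightarrow> ('i \<Rightarrow> 'a \<Rightarrow> ereal) \<Rightarrow> 'a \<Rightarrow> ereal" where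
  "pos_sum I f x = (\<Sum>\<^sub>\<infinity>i\<in>I. max (f i x) 0)"

lemma pos_sum_eq_SUP:
  "pos_sum I f x = (SUP J\<in>{J. finite J \<and> J \<subseteq> I}. \<Sum>i\<in>J. max (f i x) 0)"
  unfolding pos_sum_def by (rule nonneg_infsum_complete) simp

definition l1_sol :: "'i set \<Rightarrow> ('i \<Rightarrow> 'a \<Rightarrow> ereal) \<Rightarrow> 'a set" where
  "l1_sol I f = {x. \<forall>y. pos_sum I f x \<le> pos_sum I f y}"

section \<open>Sets\<close>

definition fin_dim_subspace :: "'a::real_vector set \<Rightarrow> bool" where
  "fin_dim_subspace L \<longleftrightarrow> (\<exists>B. finite B \<and> L = span B)"

text \<open>\<^term>\<open>cone hull {}\<close> is empty in the library, hence the explicit origin.\<close>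

definition closed_cone :: "'b::{real_vector,topological_space} set \<Rightarrow> 'b set" where
  "closed_cone A = closure (cone hull (insert 0 A))"

definition closed_convex_regarding ::
    "'b::{real_vector,topological_space} set \<Rightarrow> 'b set \<Rightarrow> bool" where
  "closed_convex_regarding C B \<longleftrightarrow> B \<inter> closure (convex hull C) = B \<inter> C"

definition is_maximum :: "ereal \<Rightarrow> ereal set \<Rightarrow> bool" where
  "is_maximum m S \<longleftrightarrow> m \<in> S \<and> (\<forall>s\<in>S. s \<le> m)"

end

theory Submission
  imports Defs
begin

text \<open>Since the system is inconsistent, the sum \<open>h\<close> of the positive parts equals the robust sum. By
  Fenchel--Moreau, applied to each \<open>f\<^sub>i\<close>, \<open>h\<close> is the supremum of the affine functions
  \<open>\<langle>\<phi>, x\<rangle> - s\<close> with \<open>(\<phi>, s)\<close> in the union \<open>C\<close> of the sums of epigraphs.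

  The subspace hypothesis forces the recession directions of the level sets of \<open>h\<close> to form a linear
  space \<open>L\<close> along which \<open>h\<close> is constant. Weak local compactness makes \<open>L\<close> finite dimensional; in the
  kernel of a continuous projection onto \<open>L\<close> the level sets are closed, convex, weakly locally compact
  and free of half-lines, hence weakly compact, so \<open>h\<close> attains its infimum \<open>m\<close> there.

  For the duality, separation in \<open>X\<^sup>* \<times> \<real>\<close> gives that \<open>(0, s)\<close> lies in the closed convex hull of \<open>C\<close>
  iff \<open>s \<ge> - m\<close>, and both sides of the equivalence say that \<open>(0, - m)\<close> lies in \<open>C\<close> itself.\<close>

section \<open>Hahn--Banach for sublinear functionals\<close>

text \<open>Homogeneity is asked for strictly positive factors only; the value at \<open>0\<close>
  then follows by taking the factor \<open>2\<close>.\<close>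

definition sublinear :: "('v::real_vector \<Rightarrow> real) \<Rightarrow> bool" where
  "sublinear p \<longleftrightarrow>
     (\<forall>x y. p (x + y) \<le> p x + p y) \<and> (\<forall>c x. 0 < c \<longrightarrow> p (c *\<^sub>R x) = c * p x)"

lemma sublinear_add: "sublinear p \<Longrightarrow> p (x + y) \<le> p x + p y"
  and sublinear_scaleR_pos: "sublinear p \<Longrightarrow> 0 < c \<Longrightarrow> p (c *\<^sub>R x) = c * p x"
  by (auto simp: sublinear_def)

lemma sublinear_zero: "sublinear p \<Longrightarrow> p 0 = 0"
  using sublinear_scaleR_pos[of p 2 0] by simp

lemma sublinear_scaleR: "sublinear p \<Longrightarrow> 0 \<le> c \<Longrightarrow> p (c *\<^sub>R x) = c * p x"
  by (cases "c = 0") (auto simp: sublinear_zero sublinear_scaleR_pos)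

lemma sublinear_ge_minus: "sublinear p \<Longrightarrow> - p (- x) \<le> p x"
  using sublinear_add[of p x "- x"] sublinear_zero[of p] by simp

text \<open>The lower bound of \<open>q\<close> obtained by moving along the ray of direction
  \<open>a\<close> and refunding the cost \<open>t * q a\<close>. It is the standard device for
  perturbing a sublinear functional downwards: the parameter \<open>1\<close> shows that its value
  at \<open>- a\<close> is at most \<open>- q a\<close>.\<close>

definition sublinear_shift :: "('v::real_vector \<Rightarrow> real) \<Rightarrow> 'v \<Rightarrow> 'v \<Rightarrow> real" where
  "sublinear_shift q a x = (INF t\<in>{0..}. q (x + t *\<^sub>R a) - t * q a)"

context
  fixes q :: "'v::real_vector \<Rightarrow> real"
  assumes q: "sublinear q"
begin

lemma sublinear_shift_le:
  assumes "0 \<le> t"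
  shows "sublinear_shift q a x \<le> q (x + t *\<^sub>R a) - t * q a"
  unfolding sublinear_shift_def
proof (rule cINF_lower)
  \<comment> \<open>Subadditivity for \<open>s *\<^sub>R a = (x + s *\<^sub>R a) + (- x)\<close>;
    the real infimum is meaningful only with such a bound.\<close>
  have "- q (- x) \<le> q (x + s *\<^sub>R a) - s * q a" if "0 \<le> s" for s
    using sublinear_add[OF q, of "x + s *\<^sub>R a" "- x"] sublinear_scaleR[OF q that, of a] by simp
  then show "bdd_below ((\<lambda>t. q (x + t *\<^sub>R a) - t * q a) ` {0..})"
    by (intro bdd_belowI2[of _ "- q (- x)"]) simp
qed (use assms in simp)

lemma sublinear_shift_greatest:
  assumes "\<And>t. 0 \<le> t \<Longrightarrow> m \<le> q (x + t *\<^sub>R a) - t * q a"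
  shows "m \<le> sublinear_shift q a x"
  unfolding sublinear_shift_def by (rule cINF_greatest) (use assms in auto)

lemma sublinear_shift_scaleR_le:
  assumes "0 < c"
  shows "sublinear_shift q a (c *\<^sub>R x) \<le> c * sublinear_shift q a x"
proof -
  have "sublinear_shift q a (c *\<^sub>R x) / c \<le> sublinear_shift q a x"
  proof (rule sublinear_shift_greatest)
    fix t :: real assume "0 \<le> t"
    then have "sublinear_shift q a (c *\<^sub>R x) \<le> q (c *\<^sub>R x + (c * t) *\<^sub>R a) - (c * t) * q a"
      using assms by (intro sublinear_shift_le) simp
    also have "q (c *\<^sub>R x + (c * t) *\<^sub>R a) = c * q (x + t *\<^sub>R a)"
      using sublinear_scaleR_pos[OF q assms, of "x + t *\<^sub>R a"] by (simp add: scaleR_add_right)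
    finally show "sublinear_shift q a (c *\<^sub>R x) / c \<le> q (x + t *\<^sub>R a) - t * q a"
      using assms by (simp add: field_simps)
  qed
  then show ?thesis
    using assms by (simp add: field_simps)
qed

text \<open>Subadditivity comes from adding parameters: \<open>t\<close> for \<open>x\<close> and
  \<open>s\<close> for \<open>y\<close> give the admissible parameter \<open>t + s\<close> for
  \<open>x + y\<close>. In the homogeneity law one inequality is the scaling bound for
  \<open>c\<close>, the other the same bound for \<open>inverse c\<close>.\<close>

lemma sublinear_sublinear_shift: "sublinear (sublinear_shift q a)"
  unfolding sublinear_def
proof (intro conjI allI impI)
  fix x y
  have "sublinear_shift q a (x + y) - (q (y + s *\<^sub>R a) - s * q a) \<le> sublinear_shift q a x"
    if "0 \<le> s" for s
  proof (rule sublinear_shift_greatest)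
    fix t :: real assume "0 \<le> t"
    then have "sublinear_shift q a (x + y) \<le> q (x + y + (t + s) *\<^sub>R a) - (t + s) * q a"
      using that by (intro sublinear_shift_le) simp
    moreover have "q (x + y + (t + s) *\<^sub>R a) \<le> q (x + t *\<^sub>R a) + q (y + s *\<^sub>R a)"
      using sublinear_add[OF q, of "x + t *\<^sub>R a" "y + s *\<^sub>R a"]
      by (simp add: algebra_simps)
    ultimately show "sublinear_shift q a (x + y) - (q (y + s *\<^sub>R a) - s * q a)
        \<le> q (x + t *\<^sub>R a) - t * q a"
      by (simp add: algebra_simps)
  qed
  then have "sublinear_shift q a (x + y) - sublinear_shift q a x \<le> sublinear_shift q a y"
    by (intro sublinear_shift_greatest) (simp add: algebra_simps)
  then show "sublinear_shift q a (x + y) \<le> sublinear_shift q a x + sublinear_shift q a y"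
    by simp
next
  fix c x assume c: "0 < (c::real)"
  have "sublinear_shift q a (inverse c *\<^sub>R c *\<^sub>R x) \<le> inverse c * sublinear_shift q a (c *\<^sub>R x)"
    using c by (intro sublinear_shift_scaleR_le) simp
  then have "c * sublinear_shift q a x \<le> sublinear_shift q a (c *\<^sub>R x)"
    using c by (simp add: field_simps)
  then show "sublinear_shift q a (c *\<^sub>R x) = c * sublinear_shift q a x"
    using sublinear_shift_scaleR_le[OF c, of a x] by linarith
qed

end

text \<open>Every shift of \<open>q\<close> is sublinear and below \<open>q\<close>, so by
  minimality it is \<open>q\<close> itself. The shift bound with parameter \<open>1\<close> then
  reads as superadditivity.\<close>

lemma minimal_sublinear_linear:
  fixes q :: "'v::real_vector \<Rightarrow> real"
  assumes q: "sublinear q" and minimal: "\<And>q'. sublinear q' \<Longrightarrow> q' \<le> q \<Longrightarrow> q' = q"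
  shows "linear q"
proof -
  have shift: "sublinear_shift q a = q" for a
    using sublinear_shift_le[OF q, of 0 a]
    by (intro minimal sublinear_sublinear_shift q) (simp add: le_fun_def)
  have add: "q (x + a) = q x + q a" for x a
    using sublinear_shift_le[OF q, of 1 a x] sublinear_add[OF q, of x a] by (simp add: shift)
  have neg: "q (- x) = - q x" for x
    using add[of x "- x"] sublinear_zero[OF q] by simp
  have "q (c *\<^sub>R x) = c * q x" for c x
  proof (cases "0 \<le> c")
    case False
    then have "q (- ((- c) *\<^sub>R x)) = - ((- c) * q x)"
      using sublinear_scaleR[OF q, of "- c" x] neg by simp
    then show ?thesis by simp
  qed (simp add: sublinear_scaleR[OF q])
  then show ?thesis
    by (intro linearI) (simp_all add: add)
qed

text \<open>Provides the lower bounds that Zorn's lemma asks for. Comparability is used twice: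
  against a fixed member \<open>q0\<close> it bounds the values from below, and for two members it
  gives a common lower one, from which subadditivity of the infimum follows.\<close>

lemma sublinear_Inf_chain:
  fixes Q :: "('v::real_vector \<Rightarrow> real) set"
  assumes "Q \<noteq> {}" and sub: "\<And>q. q \<in> Q \<Longrightarrow> sublinear q"
    and chain: "\<And>q q'. q \<in> Q \<Longrightarrow> q' \<in> Q \<Longrightarrow> q \<le> q' \<or> q' \<le> q"
  shows "sublinear (\<lambda>x. INF q\<in>Q. q x)" and "\<And>q. q \<in> Q \<Longrightarrow> (\<lambda>x. INF q\<in>Q. q x) \<le> q"
proof -
  obtain q0 where q0: "q0 \<in> Q" using assms(1) by blast
  have bdd: "bdd_below ((\<lambda>q. q x) ` Q)" for x
  proof (rule bdd_belowI2)
    fix q assume "q \<in> Q"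
    then consider "q \<le> q0" | "q0 \<le> q" using chain q0 by blast
    then show "- q0 (- x) \<le> q x"
    proof cases
      case 1
      then show ?thesis
        using sublinear_ge_minus[OF sub[OF \<open>q \<in> Q\<close>], of x] by (simp add: le_fun_def) (smt (verit))
    next
      case 2
      then show ?thesis
        using sublinear_ge_minus[OF sub[OF q0], of x] by (simp add: le_fun_def) (smt (verit))
    qed
  qed
  show le: "(\<lambda>x. INF q\<in>Q. q x) \<le> q" if "q \<in> Q" for q
    using cINF_lower[OF bdd that] by (simp add: le_fun_def)
  show "sublinear (\<lambda>x. INF q\<in>Q. q x)"
    unfolding sublinear_def
  proof (intro conjI allI impI)
    fix x y
    have *: "(INF q\<in>Q. q (x + y)) \<le> q x + q' y" if qq: "q \<in> Q" "q' \<in> Q" for q q'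
    proof -
      obtain p where p: "p \<in> Q" "p \<le> q" "p \<le> q'"
        using chain[OF qq] qq by blast
      then show ?thesis
        using cINF_lower[OF bdd p(1), of "x + y"] sublinear_add[OF sub[OF p(1)], of x y]
        by (simp add: le_fun_def) (smt (verit))
    qed
    have "(INF q\<in>Q. q (x + y)) - q' y \<le> (INF q\<in>Q. q x)" if "q' \<in> Q" for q'
      by (rule cINF_greatest[OF assms(1)]) (use *[OF _ that] in \<open>simp add: algebra_simps\<close>)
    then have "(INF q\<in>Q. q (x + y)) - (INF q\<in>Q. q x) \<le> (INF q\<in>Q. q y)"
      by (intro cINF_greatest[OF assms(1)]) (simp add: algebra_simps)
    then show "(INF q\<in>Q. q (x + y)) \<le> (INF q\<in>Q. q x) + (INF q\<in>Q. q y)"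
      by simp
  next
    fix c x assume c: "0 < (c::real)"
    have "(INF q\<in>Q. q (c *\<^sub>R x)) = (INF q\<in>Q. c * q x)"
      using sub c by (intro INF_cong) (auto simp: sublinear_scaleR_pos)
    also have "\<dots> = c * (INF q\<in>Q. q x)"
    proof (rule antisym)
      have "(INF q\<in>Q. c * q x) / c \<le> (INF q\<in>Q. q x)"
      proof (rule cINF_greatest[OF assms(1)])
        fix q assume "q \<in> Q"
        obtain m where "\<And>q. q \<in> Q \<Longrightarrow> m \<le> q x"
          using bdd[of x] by (auto simp: bdd_below_def)
        then have "bdd_below ((\<lambda>q. c * q x) ` Q)"
          using c by (intro bdd_belowI2[of _ "c * m"] mult_left_mono) auto
        from cINF_lower[OF this \<open>q \<in> Q\<close>] show "(INF q\<in>Q. c * q x) / c \<le> q x"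
          using c by (simp add: field_simps)
      qed
      then show "(INF q\<in>Q. c * q x) \<le> c * (INF q\<in>Q. q x)"
        using c by (simp add: field_simps)
      show "c * (INF q\<in>Q. q x) \<le> (INF q\<in>Q. c * q x)"
        using c cINF_lower[OF bdd] by (intro cINF_greatest[OF assms(1)] mult_left_mono) auto
    qed
    finally show "(INF q\<in>Q. q (c *\<^sub>R x)) = c * (INF q\<in>Q. q x)" .
  qed
qed

text \<open>Zorn's lemma is applied below \<open>sublinear_shift p z\<close> instead of
  \<open>p\<close>. A minimal element is linear and at most \<open>- p z\<close> at
  \<open>- z\<close>, which forces equality with \<open>p\<close> at \<open>z\<close>.\<close>

theorem Hahn_Banach_sublinear:
  fixes p :: "'v::real_vector \<Rightarrow> real"
  assumes p: "sublinear p"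
  obtains f where "linear f" "\<And>x. f x \<le> p x" "f z = p z"
proof -
  define A where "A = {q. sublinear q \<and> q \<le> sublinear_shift p z}"
  have "\<exists>m\<in>A. \<forall>a\<in>A. a \<le> m \<longrightarrow> a = m"
  proof (rule predicate_Zorn)
    show "partial_order_on A (relation_of (\<lambda>q q'. q' \<le> q) A)"
      by (rule partial_order_on_relation_ofI) auto
    fix Q assume "Q \<in> Chains (relation_of (\<lambda>q q'. q' \<le> q) A)"
    then have QA: "Q \<subseteq> A" and chain: "\<And>q q'. q \<in> Q \<Longrightarrow> q' \<in> Q \<Longrightarrow> q \<le> q' \<or> q' \<le> q"
      by (auto simp: Chains_def relation_of_def)
    show "\<exists>u\<in>A. \<forall>a\<in>Q. u \<le> a"
    proof (cases "Q = {}")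
      case True
      then show ?thesis
        using sublinear_sublinear_shift[OF p, of z] by (auto simp: A_def)
    next
      case False
      have sub: "\<And>q. q \<in> Q \<Longrightarrow> sublinear q" using QA by (auto simp: A_def)
      note inf = sublinear_Inf_chain[OF False sub chain]
      obtain q where "q \<in> Q" using False by blast
      then have "(\<lambda>x. INF q\<in>Q. q x) \<le> sublinear_shift p z"
        using inf(2)[of q] QA by (auto simp: A_def intro: order_trans)
      then show ?thesis
        using inf by (intro bexI[of _ "\<lambda>x. INF q\<in>Q. q x"]) (auto simp: A_def)
    qed
  qed
  \<comment> \<open>A sublinear functional below an element of \<open>A\<close> is again in
    \<open>A\<close>, so minimality in \<open>A\<close> is minimality among all sublinear
    functionals.\<close>
  then obtain f where f: "sublinear f" "f \<le> sublinear_shift p z"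
    and min: "\<And>a. sublinear a \<Longrightarrow> a \<le> f \<Longrightarrow> a = f"
    unfolding A_def by (blast intro: order_trans)
  have lin: "linear f"
    using minimal_sublinear_linear[OF f(1) min] by blast
  have le: "f x \<le> p x" for x
    using f(2) sublinear_shift_le[OF p, of 0 z x] by (auto simp: le_fun_def intro: order_trans)
  have "f (- z) \<le> - p z"
    using f(2) sublinear_shift_le[OF p, of 1 z "- z"] sublinear_zero[OF p]
    by (auto simp: le_fun_def intro: order_trans)
  then have "f z = p z"
    using le[of z] linear_neg[OF lin, of z] by simp
  then show thesis using that lin le by blast
qed

section \<open>Separation and conjugation in locally convex spaces\<close>

definition minkowski_gauge :: "'v::real_vector set \<Rightarrow> 'v \<Rightarrow> real" where
  "minkowski_gauge U x = Inf {t. 0 < t \<and> inverse t *\<^sub>R x \<in> U}"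

context
  fixes U :: "'v::real_vector set"
  assumes convex: "convex U" and zero: "0 \<in> U"
    and absorbing: "\<And>x. \<exists>t>0. t *\<^sub>R x \<in> U"
begin

lemma minkowski_gauge_le: "0 < t \<Longrightarrow> inverse t *\<^sub>R x \<in> U \<Longrightarrow> minkowski_gauge U x \<le> t"
  unfolding minkowski_gauge_def by (intro cInf_lower bdd_belowI[of _ 0]) auto

lemma minkowski_gauge_greatest:
  assumes "\<And>t. 0 < t \<Longrightarrow> inverse t *\<^sub>R x \<in> U \<Longrightarrow> m \<le> t"
  shows "m \<le> minkowski_gauge U x"
  unfolding minkowski_gauge_def
proof (rule cInf_greatest)
  obtain t where "t > 0" "t *\<^sub>R x \<in> U" using absorbing by blast
  then have "inverse t \<in> {t. 0 < t \<and> inverse t *\<^sub>R x \<in> U}" by simp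
  then show "{t. 0 < t \<and> inverse t *\<^sub>R x \<in> U} \<noteq> {}" by blast
qed (use assms in auto)

lemma minkowski_gauge_scaleR_le:
  assumes "0 < c"
  shows "minkowski_gauge U (c *\<^sub>R x) \<le> c * minkowski_gauge U x"
proof -
  have "minkowski_gauge U (c *\<^sub>R x) / c \<le> minkowski_gauge U x"
  proof (rule minkowski_gauge_greatest)
    fix t :: real assume "0 < t" "inverse t *\<^sub>R x \<in> U"
    then have "minkowski_gauge U (c *\<^sub>R x) \<le> c * t"
      using assms by (intro minkowski_gauge_le) (simp_all add: field_simps)
    then show "minkowski_gauge U (c *\<^sub>R x) / c \<le> t"
      using assms by (simp add: field_simps)
  qed
  then show ?thesis using assms by (simp add: field_simps)
qed

lemma sublinear_minkowski_gauge: "sublinear (minkowski_gauge U)"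
  unfolding sublinear_def
proof (intro conjI allI impI)
  fix x y
  have sum: "minkowski_gauge U (x + y) \<le> t + s"
    if t: "0 < t" "inverse t *\<^sub>R x \<in> U" and s: "0 < s" "inverse s *\<^sub>R y \<in> U" for t s
  proof (rule minkowski_gauge_le)
    have "(t / (t + s)) *\<^sub>R inverse t *\<^sub>R x + (s / (t + s)) *\<^sub>R inverse s *\<^sub>R y \<in> U"
      using t s by (intro convexD[OF convex]) (auto simp: add_divide_distrib[symmetric])
    then show "inverse (t + s) *\<^sub>R (x + y) \<in> U"
      using t s by (simp add: scaleR_add_right inverse_eq_divide)
  qed (use t s in simp)
  have "minkowski_gauge U (x + y) - s \<le> minkowski_gauge U x" if "0 < s" "inverse s *\<^sub>R y \<in> U" for s
    using sum[OF _ _ that] by (intro minkowski_gauge_greatest) (simp add: algebra_simps)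
  then have "minkowski_gauge U (x + y) - minkowski_gauge U x \<le> minkowski_gauge U y"
    by (intro minkowski_gauge_greatest) (simp add: algebra_simps)
  then show "minkowski_gauge U (x + y) \<le> minkowski_gauge U x + minkowski_gauge U y" by simp
next
  fix c x assume c: "0 < (c::real)"
  have "minkowski_gauge U (inverse c *\<^sub>R c *\<^sub>R x) \<le> inverse c * minkowski_gauge U (c *\<^sub>R x)"
    using c by (intro minkowski_gauge_scaleR_le) simp
  then have "c * minkowski_gauge U x \<le> minkowski_gauge U (c *\<^sub>R x)"
    using c by (simp add: field_simps)
  then show "minkowski_gauge U (c *\<^sub>R x) = c * minkowski_gauge U x"
    using minkowski_gauge_scaleR_le[OF c, of x] by linarith
qed

lemma minkowski_gauge_ge_one:
  assumes "x \<notin> U"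
  shows "1 \<le> minkowski_gauge U x"
proof (rule minkowski_gauge_greatest)
  fix t :: real assume t: "0 < t" "inverse t *\<^sub>R x \<in> U"
  show "1 \<le> t"
  proof (rule ccontr)
    assume "\<not> 1 \<le> t"
    then have "t *\<^sub>R inverse t *\<^sub>R x + (1 - t) *\<^sub>R 0 \<in> U"
      using t zero by (intro convexD[OF convex]) auto
    then show False using t assms by simp
  qed
qed

end

text \<open>The set \<open>V\<close> stands for a neighbourhood of the origin, but no topology
  enters. The point \<open>x0 - s0\<close> lies outside \<open>U\<close>, the sum of
  \<open>S - s0\<close> and \<open>V\<close>, so the gauge of \<open>U\<close> is at least
  \<open>1\<close> there, and a linear functional below the gauge touching it at that point
  separates. The bound on \<open>V\<close> later yields continuity of the functional.\<close>

lemma algebraic_separation: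
  fixes S V :: "'v::real_vector set"
  assumes "convex S" "S \<noteq> {}" "convex V" and symmetric: "\<And>v. v \<in> V \<Longrightarrow> - v \<in> V"
    and absorbing: "\<And>x. \<exists>t>0. t *\<^sub>R x \<in> V"
    and disjoint: "\<And>s. s \<in> S \<Longrightarrow> s - x0 \<notin> V"
  obtains f e where "linear f" "0 < e" "\<And>s. s \<in> S \<Longrightarrow> f s \<le> f x0 - e"
    "\<And>v. v \<in> V \<Longrightarrow> \<bar>f v\<bar> \<le> (1::real)"
proof -
  obtain s0 where s0: "s0 \<in> S" using assms by blast
  define U where "U = (\<Union>x\<in>(\<lambda>s. s - s0) ` S. \<Union>v\<in>V. {x + v})"
  have memU: "s - s0 + v \<in> U" if "s \<in> S" "v \<in> V" for s v
    using that by (auto simp: U_def)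
  have VU: "v \<in> U" if "v \<in> V" for v
    using memU[OF s0 that] by simp
  have V0: "0 \<in> V"
    using absorbing[of 0] by auto
  have U: "convex U"
    unfolding U_def by (intro convex_sums convex_translation_subtract assms)
  have U0: "0 \<in> U" using VU V0 by blast
  have Uabs: "\<exists>t>0. t *\<^sub>R x \<in> U" for x
    using absorbing[of x] VU by blast
  have "x0 - s0 \<notin> U"
  proof
    assume "x0 - s0 \<in> U"
    then obtain s v where sv: "s \<in> S" "v \<in> V" "x0 - s0 = s - s0 + v"
      by (auto simp: U_def)
    then have "s - x0 = - v" by (simp add: algebra_simps)
    then show False using disjoint symmetric sv by metis
  qed
  then have ge: "1 \<le> minkowski_gauge U (x0 - s0)"
    using minkowski_gauge_ge_one[OF U U0 Uabs] by blast
  obtain f where f: "linear f" "\<And>x. f x \<le> minkowski_gauge U x" "f (x0 - s0) = minkowski_gauge U (x0 - s0)"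
    using Hahn_Banach_sublinear[OF sublinear_minkowski_gauge[OF U U0 Uabs]] by blast
  have le1: "f u \<le> 1" if "u \<in> U" for u
    using f(2)[of u] minkowski_gauge_le[OF U U0 Uabs, of 1 u] that by simp
  \<comment> \<open>Adding this element of \<open>V\<close> to any \<open>s - s0\<close> stays
    inside \<open>U\<close>; this is the source of the gap \<open>e\<close>, uniform in
    \<open>s\<close>.\<close>
  obtain t where t: "t > 0" "t *\<^sub>R (x0 - s0) \<in> V" using absorbing by blast
  show thesis
  proof (rule that[OF f(1)])
    show "0 < t * f (x0 - s0)" using t f(3) ge by simp
    fix s assume "s \<in> S"
    from le1[OF memU[OF this t(2)]] have "f s - f s0 + t * f (x0 - s0) \<le> 1"
      by (simp only: linear_add[OF f(1)] linear_diff[OF f(1)] linear_scale[OF f(1)] real_scaleR_def)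
    moreover have "1 \<le> f x0 - f s0"
      using ge f(3) linear_diff[OF f(1)] by simp
    ultimately show "f s \<le> f x0 - t * f (x0 - s0)" by linarith
  next
    fix v assume "v \<in> V"
    then show "\<bar>f v\<bar> \<le> 1"
      using le1[OF VU] symmetric linear_neg[OF f(1), of v] by (fastforce simp: abs_le_iff)
  qed
qed

section \<open>Neighbourhoods of the origin and continuity of linear functionals\<close>

lemma tendsto_scaleR_lctvs:
  fixes x :: "'a::lctvs"
  assumes "(c \<longlongrightarrow> c0) F" "(g \<longlongrightarrow> x) F"
  shows "((\<lambda>t. c t *\<^sub>R g t) \<longlongrightarrow> c0 *\<^sub>R x) F"
  using filterlim_compose[OF tendsto_scaleR_prod filterlim_Pair[OF assms]] by simp

lemma continuous_on_scaleR_lctvs: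
  fixes g :: "'b::topological_space \<Rightarrow> 'a::lctvs"
  shows "continuous_on S c \<Longrightarrow> continuous_on S g \<Longrightarrow> continuous_on S (\<lambda>t. c t *\<^sub>R g t)"
  by (simp add: continuous_on_def tendsto_scaleR_lctvs)

lemma open_absorbing:
  fixes x :: "'a::lctvs"
  assumes "open V" "0 \<in> V"
  shows "\<exists>t>0. t *\<^sub>R x \<in> V"
proof -
  have "((\<lambda>t. t *\<^sub>R x) \<longlongrightarrow> 0 *\<^sub>R x) (at_right 0)"
    by (intro tendsto_scaleR_lctvs tendsto_intros)
  then have "\<forall>\<^sub>F t in at_right 0. t *\<^sub>R x \<in> V"
    using assms by (auto dest!: topological_tendstoD)
  moreover have "\<forall>\<^sub>F t in at_right (0::real). t > 0"
    by (rule eventually_at_right_less)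
  ultimately have "\<forall>\<^sub>F t in at_right 0. t > 0 \<and> t *\<^sub>R x \<in> V"
    by eventually_elim simp
  then show ?thesis
    using eventually_happens'[OF trivial_limit_at_right_real] by blast
qed

lemma symmetric_convex_nhd:
  fixes U :: "'a::lctvs set"
  assumes "open U" "0 \<in> U"
  obtains V where "open V" "convex V" "0 \<in> V" "V \<subseteq> U" "\<And>v. v \<in> V \<Longrightarrow> - v \<in> V"
proof -
  obtain W where W: "open W" "convex W" "0 \<in> W" "W \<subseteq> U"
    using locally_convex[OF assms] by blast
  show thesis
  proof (rule that[of "W \<inter> uminus -` W"])
    show "open (W \<inter> uminus -` W)"
      using W by (intro open_Int open_vimage continuous_on_minus continuous_on_id)
    show "convex (W \<inter> uminus -` W)"
      using W by (intro convex_Int convex_linear_vimage linear_uminus)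
  qed (use W in auto)
qed

lemma linear_bounded_nhd_continuous:
  fixes f :: "'a::lctvs \<Rightarrow> real"
  assumes f: "linear f" and V: "open V" "0 \<in> V" and bound: "\<And>v. v \<in> V \<Longrightarrow> \<bar>f v\<bar> \<le> 1"
  shows "continuous_on UNIV f"
proof -
  have "(f \<longlongrightarrow> f x) (nhds x)" for x
  proof (rule tendstoI)
    fix e :: real assume e: "e > 0"
    \<comment> \<open>The factor \<open>2 / e\<close> leads to the bound \<open>e / 2\<close>, hence
      to a strict inequality.\<close>
    have "open ((\<lambda>y. (2 / e) *\<^sub>R (y - x)) -` V)"
      by (intro open_vimage V continuous_on_scaleR_lctvs continuous_intros)
    then have "\<forall>\<^sub>F y in nhds x. (2 / e) *\<^sub>R (y - x) \<in> V"
      unfolding eventually_nhds using V by fastforce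
    then show "\<forall>\<^sub>F y in nhds x. dist (f y) (f x) < e"
    proof eventually_elim
      case (elim y)
      have "\<bar>(2 / e) * (f y - f x)\<bar> \<le> 1"
        using bound[OF elim] by (simp only: linear_diff[OF f] linear_scale[OF f] real_scaleR_def)
      then show ?case
        using e by (simp add: dist_real_def abs_mult field_simps)
    qed
  qed
  then show ?thesis
    by (simp add: continuous_on_def tendsto_within_subset tendsto_at_iff_tendsto_nhds)
qed

section \<open>The dual space\<close>

lemma dual_apply_linear: "linear (dual_apply \<phi>)"
  and dual_apply_continuous: "continuous_on S (dual_apply \<phi>)"
  using dual_apply[of \<phi>] by (auto intro: continuous_on_subset)

lemmas dual_simps [simp] =
  linear_0[OF dual_apply_linear] linear_add[OF dual_apply_linear]
  linear_diff[OF dual_apply_linear] linear_neg[OF dual_apply_linear]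
  linear_scale[OF dual_apply_linear]
  zero_dual.rep_eq plus_dual.rep_eq minus_dual.rep_eq uminus_dual.rep_eq scaleR_dual.rep_eq

lemma dual_apply_sum [simp]: "dual_apply (\<Sum>j\<in>J. \<xi> j) x = (\<Sum>j\<in>J. dual_apply (\<xi> j) x)"
  by (induction J rule: infinite_finite_induct) auto

lemma dual_of_linear:
  assumes "linear f" "continuous_on UNIV f"
  obtains \<phi> where "dual_apply \<phi> = f"
  using Dual_inverse[of f] assms by blast

text \<open>By the Hausdorff property some symmetric convex neighbourhood of \<open>0\<close> misses
  \<open>x\<close>; separating the singleton of \<open>0\<close> from \<open>x\<close> gives a
  functional positive at \<open>x\<close>.\<close>

lemma dual_separates_points:
  fixes x :: "'a::lctvs"
  assumes "x \<noteq> 0"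
  obtains \<phi> where "dual_apply \<phi> x \<noteq> 0"
proof -
  obtain W where "open W" "0 \<in> W" "x \<notin> W"
    using t1_space[of 0 x] assms by auto
  then obtain V where V: "open V" "convex V" "0 \<in> V" "x \<notin> V" "\<And>v. v \<in> V \<Longrightarrow> - v \<in> V"
    by (metis symmetric_convex_nhd subsetD)
  then have "- x \<notin> V" by force
  then obtain f e where f: "linear f" "0 < e" "\<And>s. s \<in> {0} \<Longrightarrow> f s \<le> f x - e"
      "\<And>v. v \<in> V \<Longrightarrow> \<bar>f v\<bar> \<le> (1::real)"
    using algebraic_separation[of "{0}" V x] V open_absorbing[OF V(1,3)] by auto
  obtain \<phi> where "dual_apply \<phi> = f"
    using dual_of_linear[OF f(1) linear_bounded_nhd_continuous[OF f(1) V(1,3) f(4)]] by blast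
  then show thesis
    using that[of \<phi>] f(2,3) linear_0[OF f(1)] by simp
qed

section \<open>Conjugates as continuous affine minorants, and the Fenchel--Moreau theorem\<close>

lemma conjugate_le_iff:
  "conjugate f \<phi> \<le> ereal s \<longleftrightarrow> (\<forall>x. ereal (dual_apply \<phi> x - s) \<le> f x)"
proof -
  have "ereal (dual_apply \<phi> x) - f x \<le> ereal s \<longleftrightarrow> ereal (dual_apply \<phi> x - s) \<le> f x" for x
    by (cases "f x") auto
  then show ?thesis
    by (simp add: conjugate_def SUP_le_iff)
qed

lemma convex_epi:
  fixes f :: "'a::real_vector \<Rightarrow> ereal"
  assumes "convex_fun f"
  shows "convex (epi f)"
  unfolding convex_alt
proof (intro ballI allI impI)
  fix p q :: "'a \<times> real" and u :: real
  assume pq: "p \<in> epi f" "q \<in> epi f" and u: "0 \<le> u \<and> u \<le> 1"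
  obtain x r y s where [simp]: "p = (x, r)" "q = (y, s)" by (metis surj_pair)
  have le: "f x \<le> ereal r" "f y \<le> ereal s" using pq by (auto simp: epi_def)
  \<comment> \<open>\<open>convex_fun\<close> speaks of strictly interior weights only, so the end
    points are treated apart.\<close>
  consider "u = 0" | "u = 1" | "0 < u" "u < 1" using u by linarith
  then show "(1 - u) *\<^sub>R p + u *\<^sub>R q \<in> epi f"
  proof cases
    case 3
    then have "f ((1 - u) *\<^sub>R x + u *\<^sub>R y) \<le> ereal (1 - u) * f x + ereal u * f y"
      using assms by (auto simp: convex_fun_def)
    also have "\<dots> \<le> ereal (1 - u) * ereal r + ereal u * ereal s"
      using le 3 by (intro add_mono ereal_mult_left_mono) auto
    finally show ?thesis by (simp add: epi_def)
  qed (use pq in auto)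
qed

text \<open>A vertical separating hyperplane can only occur outside the effective domain.\<close>

lemma epi_separation:
  fixes f :: "'a::lctvs \<Rightarrow> ereal"
  assumes f: "f \<in> proper_lsc_convex" and a: "ereal a < f x"
  obtains (minorant) \<phi> s where "conjugate f \<phi> \<le> ereal s" "a < dual_apply \<phi> x - s"
  | (vertical) \<phi> e where "0 < e" "\<And>y. f y < \<infinity> \<Longrightarrow> dual_apply \<phi> y \<le> dual_apply \<phi> x - e"
proof -
  have fp: "proper f" "lsc f" "convex_fun f" using f by (auto simp: proper_lsc_convex_def)
  obtain b where b: "ereal a < ereal b" "ereal b < f x"
    using ereal_dense2[OF a] by blast
  have "\<forall>\<^sub>F y in nhds x. ereal b < f y"
    using fp(2) b(2) by (simp add: lsc_def)
  then obtain W where W: "open W" "x \<in> W" "\<And>y. y \<in> W \<Longrightarrow> ereal b < f y"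
    by (auto simp: eventually_nhds)
  have "open ((\<lambda>v. x + v) -` W)"
    by (intro open_vimage W continuous_intros)
  then obtain V where V: "open V" "convex V" "0 \<in> V" "V \<subseteq> (\<lambda>v. x + v) -` W"
      "\<And>v. v \<in> V \<Longrightarrow> - v \<in> V"
    by (rule symmetric_convex_nhd) (use W in auto)
  \<comment> \<open>Translated to \<open>(x, a)\<close>, this box misses \<open>epi f\<close>: over
    it \<open>f\<close> exceeds \<open>b\<close>, whereas the heights stay below
    \<open>b\<close>.\<close>
  define N where "N = V \<times> {- (b - a) <..< b - a}"
  have "convex N"
    unfolding N_def by (intro convex_Times V) simp
  have Nsym: "- v \<in> N" if "v \<in> N" for v
    using that V(5) by (auto simp: N_def)
  have Nabs: "\<exists>t>0. t *\<^sub>R p \<in> N" for p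
  proof -
    obtain t where t: "t > 0" "t *\<^sub>R fst p \<in> V" using open_absorbing[OF V(1,3)] by blast
    obtain t' where t': "t' > 0" "t' *\<^sub>R snd p \<in> {- (b - a) <..< b - a}"
      using open_absorbing[of "{- (b - a) <..< b - a}" "snd p"] b by auto
    \<comment> \<open>Convex sets containing \<open>0\<close> are star-shaped, so the smaller of the
      two absorbing factors serves both components.\<close>
    have star: "(min t t' / u) *\<^sub>R u *\<^sub>R z \<in> C"
      if "convex C" "0 \<in> C" "u *\<^sub>R z \<in> C" "u > 0" "min t t' \<le> u" for u and z :: "'c::real_vector" and C
      using convexD[OF that(1,3,2), of "min t t' / u" "1 - min t t' / u"] that t t' by auto
    have "min t t' *\<^sub>R p \<in> N"
      using star[OF V(2,3) t(2) t(1)] star[OF _ _ t'(2) t'(1)] t t' b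
      by (auto simp: N_def mem_Times_iff)
    then show ?thesis using t t' by (intro exI[of _ "min t t'"]) auto
  qed
  have ne: "epi f \<noteq> {}"
  proof -
    obtain y where "f y \<noteq> \<infinity>" "f y \<noteq> -\<infinity>" using fp(1) by (auto simp: proper_def)
    then have "(y, real_of_ereal (f y)) \<in> epi f" by (auto simp: epi_def ereal_real)
    then show ?thesis by blast
  qed
  have disj: "p - (x, a) \<notin> N" if "p \<in> epi f" for p
  proof
    assume "p - (x, a) \<in> N"
    then have "fst p - x \<in> V" and lt: "snd p < b" by (auto simp: N_def mem_Times_iff)
    then have "fst p \<in> W" using V(4) by force
    then have "ereal b < f (fst p)" using W by blast
    moreover have "f (fst p) \<le> ereal (snd p)" using that by (auto simp: epi_def)
    ultimately have "ereal b < ereal (snd p)" by (rule less_le_trans)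
    then show False using lt by simp
  qed
  obtain G e where G: "linear G" "0 < e" "\<And>p. p \<in> epi f \<Longrightarrow> G p \<le> G (x, a) - e"
      "\<And>v. v \<in> N \<Longrightarrow> \<bar>G v\<bar> \<le> (1::real)"
    using algebraic_separation[OF convex_epi[OF fp(3)] ne \<open>convex N\<close> Nsym Nabs disj] by blast
  define g where "g = (\<lambda>y. G (y, 0))"
  define c where "c = G (0, 1)"
  have Gsplit: "G (y, t) = g y + t * c" for y t
  proof -
    have "G (y, t) = G ((y, 0) + t *\<^sub>R (0, 1))" by simp
    also have "\<dots> = g y + t * c"
      by (simp only: linear_add[OF G(1)] linear_scale[OF G(1)] g_def c_def real_scaleR_def)
    finally show ?thesis .
  qed
  have "linear g"
    using linear_compose[OF _ G(1), of "\<lambda>y. (y, 0)"]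
    by (simp add: g_def o_def linear_iff)
  moreover have "\<bar>g v\<bar> \<le> 1" if "v \<in> V" for v
    using G(4)[of "(v, 0)"] that b by (simp add: N_def g_def)
  ultimately obtain \<phi> where \<phi>: "dual_apply \<phi> = g"
    using dual_of_linear linear_bounded_nhd_continuous V(1,3) by metis
  have sep: "dual_apply \<phi> y + t * c \<le> dual_apply \<phi> x + a * c - e" if "f y \<le> ereal t" for y t
    using G(3)[of "(y, t)"] that by (simp add: epi_def Gsplit \<phi>)
  \<comment> \<open>The epigraph is unbounded upwards. Under a positive slope, the height
    \<open>t\<close> below is large enough to violate the separation.\<close>
  have "c \<le> 0"
  proof (rule ccontr)
    assume "\<not> c \<le> 0"
    obtain y r where y: "f y \<le> ereal r" using ne by (auto simp: epi_def)
    define t where "t = max r ((dual_apply \<phi> x + a * c - dual_apply \<phi> y) / c)"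
    have "f y \<le> ereal t" by (rule order_trans[OF y]) (simp add: t_def)
    from sep[OF this] have "t * c \<le> dual_apply \<phi> x + a * c - dual_apply \<phi> y - e" by simp
    moreover have "dual_apply \<phi> x + a * c - dual_apply \<phi> y \<le> t * c"
      using \<open>\<not> c \<le> 0\<close> by (simp add: t_def field_simps max_def)
    ultimately show False using G(2) by linarith
  qed
  show thesis
  proof (cases "c = 0")
    case True
    show thesis
    proof (rule vertical[OF G(2)])
      fix y assume "f y < \<infinity>"
      then have "\<exists>r. f y \<le> ereal r" by (cases "f y") auto
      then obtain r where "f y \<le> ereal r" ..
      then show "dual_apply \<phi> y \<le> dual_apply \<phi> x - e" using sep[of y r] True by simp
    qed
  next
    case False
    define k where "k = - c"
    have k: "k > 0" using False \<open>c \<le> 0\<close> by (simp add: k_def)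
    \<comment> \<open>Division by the slope turns the hyperplane into the graph of an affine
      function; \<open>s\<close> is chosen such that this function takes the value
      \<open>a + e / k\<close> at \<open>x\<close>.\<close>
    define \<psi> where "\<psi> = inverse k *\<^sub>R \<phi>"
    define s where "s = dual_apply \<psi> x - a - e / k"
    have "ereal (dual_apply \<psi> y - s) \<le> f y" for y
    proof (rule ereal_le_real)
      fix t assume "f y \<le> ereal t"
      from sep[OF this] have "dual_apply \<phi> y - t * k \<le> dual_apply \<phi> x - a * k - e"
        by (simp add: k_def)
      then have "(dual_apply \<phi> y - t * k) / k \<le> (dual_apply \<phi> x - a * k - e) / k"
        using k by (intro divide_right_mono) auto
      then have "dual_apply \<psi> y - t \<le> s"
        using k by (simp add: \<psi>_def s_def diff_divide_distrib add_divide_distrib inverse_eq_divide)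
      then show "ereal (dual_apply \<psi> y - s) \<le> ereal t" by simp
    qed
    then have "conjugate f \<psi> \<le> ereal s"
      unfolding conjugate_le_iff by blast
    moreover have "a < dual_apply \<psi> x - s"
      using k G(2) by (simp add: s_def)
    ultimately show thesis by (rule minorant)
  qed
qed

text \<open>Separation at a point \<open>y\<close> where \<open>f\<close> is finite excludes the
  vertical case, which would put the functional at \<open>y\<close> strictly below itself.\<close>

lemma affine_minorant_exists:
  fixes f :: "'a::lctvs \<Rightarrow> ereal"
  assumes f: "f \<in> proper_lsc_convex"
  obtains \<phi> s where "conjugate f \<phi> \<le> ereal s"
proof -
  have "proper f" using f by (simp add: proper_lsc_convex_def)
  then obtain y where y: "f y \<noteq> \<infinity>" "f y \<noteq> -\<infinity>" by (auto simp: proper_def)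
  then have "ereal (real_of_ereal (f y) - 1) < f y" by (cases "f y") auto
  then show thesis
  proof (rule epi_separation[OF f])
    fix \<phi> and e :: real
    assume "0 < e" "\<And>z. f z < \<infinity> \<Longrightarrow> dual_apply \<phi> z \<le> dual_apply \<phi> y - e"
    from this(1) this(2)[of y] show thesis using y by simp
  qed (rule that)
qed

text \<open>In the vertical case, the affine function \<open>\<phi> - (\<phi> x - e)\<close> is
  nonpositive on the effective domain and equals \<open>e\<close> at \<open>x\<close>. Adding a
  multiple of it to any affine minorant preserves the minorant and raises its value at
  \<open>x\<close> at will.\<close>

lemma Fenchel_Moreau:
  fixes f :: "'a::lctvs \<Rightarrow> ereal"
  assumes f: "f \<in> proper_lsc_convex" and a: "ereal a < f x"
  obtains \<phi> s where "conjugate f \<phi> \<le> ereal s" "a < dual_apply \<phi> x - s"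
proof (rule epi_separation[OF f a])
  fix \<phi> and e :: real
  assume e: "0 < e" and vert: "\<And>y. f y < \<infinity> \<Longrightarrow> dual_apply \<phi> y \<le> dual_apply \<phi> x - e"
  obtain \<phi>0 s0 where minor: "conjugate f \<phi>0 \<le> ereal s0"
    using affine_minorant_exists[OF f] .
  \<comment> \<open>Large enough for the gain \<open>k * e\<close> to exceed what the minorant lacks
    to reach \<open>a\<close> at \<open>x\<close>.\<close>
  define k where "k = max 0 ((a - (dual_apply \<phi>0 x - s0) + 1) / e)"
  have k: "k \<ge> 0" and ke: "a - (dual_apply \<phi>0 x - s0) < k * e"
    using e by (auto simp: k_def max_def field_simps)
  show thesis
  proof (rule that)
    show "conjugate f (\<phi>0 + k *\<^sub>R \<phi>) \<le> ereal (s0 + k * (dual_apply \<phi> x - e))"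
      unfolding conjugate_le_iff
    proof
      fix y
      show "ereal (dual_apply (\<phi>0 + k *\<^sub>R \<phi>) y - (s0 + k * (dual_apply \<phi> x - e))) \<le> f y"
      proof (cases "f y < \<infinity>")
        case True
        then have "k * dual_apply \<phi> y \<le> k * (dual_apply \<phi> x - e)"
          using vert k by (intro mult_left_mono) auto
        then have "ereal (dual_apply (\<phi>0 + k *\<^sub>R \<phi>) y - (s0 + k * (dual_apply \<phi> x - e)))
            \<le> ereal (dual_apply \<phi>0 y - s0)" by simp
        also have "\<dots> \<le> f y" using minor by (simp add: conjugate_le_iff)
        finally show ?thesis .
      qed simp
    qed
    show "a < dual_apply (\<phi>0 + k *\<^sub>R \<phi>) x - (s0 + k * (dual_apply \<phi> x - e))"
      using ke by (simp add: algebra_simps)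
  qed
qed (rule that)

section \<open>The weak topology\<close>

text \<open>Both the weak and the weak* topology are pulled back from a product of real lines; this
  is the common source of their descriptions by finitely many evaluations.\<close>

lemma open_fun_real_nhd:
  fixes W :: "('b \<Rightarrow> real) set"
  assumes "open W" "g \<in> W"
  obtains F e where "finite F" "0 < e" "\<And>k. (\<Sum>b\<in>F. \<bar>k b - g b\<bar>) < e \<Longrightarrow> k \<in> W"
proof -
  have "openin (product_topology (\<lambda>i. euclidean) UNIV) W"
    using assms(1) by (simp add: open_fun_def)
  then obtain X where X: "g \<in> (\<Pi>\<^sub>E i\<in>UNIV. X i)" "\<And>i. open (X i)"
      "finite {i. X i \<noteq> UNIV}" "(\<Pi>\<^sub>E i\<in>UNIV. X i) \<subseteq> W"
    using product_topology_open_contains_basis[OF _ assms(2)] by force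
  have "\<exists>d>0. ball (g i) d \<subseteq> X i" for i
    using X(1,2) by (simp add: PiE_iff open_contains_ball)
  then obtain d where d: "\<And>i. d i > 0" "\<And>i. ball (g i) (d i) \<subseteq> X i" by metis
  define F where "F = {i. X i \<noteq> UNIV}"
  have F: "finite F" using X(3) by (simp add: F_def)
  show thesis
  proof (rule that[OF F])
    \<comment> \<open>Inserting \<open>1\<close> gives the minimum a value when \<open>F\<close> is
      empty.\<close>
    show "0 < Min (insert 1 (d ` F))" using F d(1) by auto
    fix k assume k: "(\<Sum>b\<in>F. \<bar>k b - g b\<bar>) < Min (insert 1 (d ` F))"
    have "k b \<in> X b" for b
    proof (cases "b \<in> F")
      case True
      then have "\<bar>k b - g b\<bar> \<le> (\<Sum>b\<in>F. \<bar>k b - g b\<bar>)"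
        using F by (intro member_le_sum) auto
      also have "\<dots> < d b" using k F True by simp
      finally have "k b \<in> ball (g b) (d b)" by (simp add: dist_real_def abs_minus_commute)
      then show ?thesis using d(2) by blast
    qed (simp add: F_def)
    then show "k \<in> W" using X(4) by auto
  qed
qed

lemma weak_star_nhd:
  fixes A :: "'a::lctvs dual set"
  assumes "open A" "\<phi>0 \<in> A"
  obtains F e where "finite F" "0 < e"
    "\<And>\<phi>. (\<Sum>x\<in>F. \<bar>dual_apply (\<phi> - \<phi>0) x\<bar>) < e \<Longrightarrow> \<phi> \<in> A"
proof -
  obtain U where U: "open U" "A = dual_apply -` U"
    using assms(1) by (auto simp: open_dual_def openin_pullback_topology)
  then obtain F e where "finite F" "0 < e"
      "\<And>k. (\<Sum>x\<in>F. \<bar>k x - dual_apply \<phi>0 x\<bar>) < e \<Longrightarrow> k \<in> U"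
    using open_fun_real_nhd[OF U(1)] assms(2) by blast
  then show thesis using that[of F e] U(2) by simp
qed

lemma continuous_on_dual_eval: "continuous_on UNIV (\<lambda>\<phi>::'a::lctvs dual. dual_apply \<phi> x)"
proof (subst continuous_on_open_vimage[OF open_UNIV], intro allI impI)
  fix B :: "real set" assume "open B"
  have "open ((\<lambda>g. g x) -` B)"
    by (intro open_vimage \<open>open B\<close> continuous_on_product_coordinates)
  then show "open ((\<lambda>\<phi>. dual_apply \<phi> x) -` B \<inter> UNIV)"
    unfolding open_dual_def openin_pullback_topology
    by (intro exI[of _ "(\<lambda>g. g x) -` B"]) auto
qed

lemma topspace_weak_topology [simp]: "topspace weak_topology = UNIV"
  by (simp add: weak_topology_def topspace_pullback_topology)

lemma weak_nhd:
  fixes x0 :: "'a::lctvs"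
  assumes "openin weak_topology W" "x0 \<in> W"
  obtains F e where "finite F" "0 < e"
    "\<And>x. (\<Sum>\<phi>\<in>F. \<bar>dual_apply \<phi> (x - x0)\<bar>) < e \<Longrightarrow> x \<in> W"
proof -
  obtain U where U: "open U" "W = (\<lambda>x \<phi>. dual_apply \<phi> x) -` U"
    using assms(1) by (auto simp: weak_topology_def openin_pullback_topology)
  then obtain F e where "finite F" "0 < e"
      "\<And>k. (\<Sum>\<phi>\<in>F. \<bar>k \<phi> - dual_apply \<phi> x0\<bar>) < e \<Longrightarrow> k \<in> U"
    using open_fun_real_nhd[OF U(1)] assms(2) by blast
  then show thesis using that[of F e] U(2) by simp
qed

lemma continuous_map_weak_dual: "continuous_map weak_topology euclideanreal (dual_apply \<phi>)"
proof -
  have "continuous_map euclidean euclideanreal (\<lambda>g::'a dual \<Rightarrow> real. g \<phi>)"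
    by (simp add: continuous_on_product_coordinates)
  from continuous_map_pullback[OF this, of UNIV "\<lambda>x \<phi>. dual_apply \<phi> x"]
  show ?thesis by (simp add: weak_topology_def o_def)
qed

lemma continuous_map_into_weak:
  assumes "\<And>\<phi>. continuous_map T euclideanreal (\<lambda>t. dual_apply \<phi> (g t))"
  shows "continuous_map T weak_topology g"
  unfolding weak_topology_def
proof (rule continuous_map_pullback')
  show "continuous_map T euclidean ((\<lambda>x \<phi>. dual_apply \<phi> x) \<circ> g)"
    unfolding euclidean_product_topology[symmetric] continuous_map_componentwise_UNIV
    using assms by (simp add: o_def)
qed simp

lemma continuous_map_weak_affine:
  "continuous_map weak_topology weak_topology (\<lambda>x::'a::lctvs. a + c *\<^sub>R (x - b))"
  by (rule continuous_map_into_weak)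
    (auto intro!: continuous_intros continuous_map_weak_dual)

lemma continuous_map_weak_linear:
  fixes P :: "'a::lctvs \<Rightarrow> 'b::lctvs"
  assumes "linear P" "continuous_on UNIV P"
  shows "continuous_map weak_topology weak_topology P"
proof (rule continuous_map_into_weak)
  fix \<phi> :: "'b dual"
  have "linear (\<lambda>x. dual_apply \<phi> (P x))"
    using linear_compose[OF assms(1) dual_apply_linear] by (simp add: o_def)
  moreover have "continuous_on UNIV (\<lambda>x. dual_apply \<phi> (P x))"
    by (rule continuous_on_compose2[OF dual_apply_continuous assms(2)]) auto
  ultimately obtain \<psi> where "dual_apply \<psi> = (\<lambda>x. dual_apply \<phi> (P x))"
    by (rule dual_of_linear)
  then show "continuous_map weak_topology euclideanreal (\<lambda>x. dual_apply \<phi> (P x))"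
    using continuous_map_weak_dual[of \<psi>] by simp
qed

lemma closedin_weak_zero: "closedin weak_topology {0::'a::lctvs}"
proof -
  have "{0::'a} = (\<Inter>\<phi>. {x \<in> topspace weak_topology. dual_apply \<phi> x \<in> {0}})"
    using dual_separates_points by fastforce
  also have "closedin weak_topology \<dots>"
    by (intro closedin_INT closedin_continuous_map_preimage[OF continuous_map_weak_dual]) auto
  finally show ?thesis .
qed

lemma closedin_weak_halfspace: "closedin weak_topology {x. dual_apply \<phi> x \<le> c}"
  using closedin_continuous_map_preimage[OF continuous_map_weak_dual, of "{..c}" \<phi>] by simp

section \<open>Weak compactness, local compactness and half-lines\<close>

lemma compactin_decseq_nonempty:
  fixes C :: "nat \<Rightarrow> 'b set"
  assumes "compactin X D" "\<And>n. closedin X (C n)" "\<And>n. C n \<subseteq> D" "\<And>n. C n \<noteq> {}" "decseq C"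
  shows "(\<Inter>n. C n) \<noteq> {}"
  using assms
  by (intro compact_space_imp_nest[of "subtopology X D"])
    (auto simp: compactin_subspace closedin_subset_topspace)

text \<open>A functional that does not vanish at \<open>d\<close> is bounded on a weakly compact set
  but unbounded along the half-line.\<close>

lemma weakly_compact_no_halfline:
  fixes d :: "'a::lctvs"
  assumes Q: "compactin weak_topology Q" and halfline: "\<And>t. 0 \<le> t \<Longrightarrow> x0 + t *\<^sub>R d \<in> Q"
  shows "d = 0"
proof (rule ccontr)
  assume "d \<noteq> 0"
  then obtain \<phi> where \<phi>: "dual_apply \<phi> d \<noteq> 0" by (rule dual_separates_points)
  have "compact (dual_apply \<phi> ` Q)"
    using image_compactin[OF Q continuous_map_weak_dual] by simp
  then obtain M where M: "\<And>x. x \<in> Q \<Longrightarrow> \<bar>dual_apply \<phi> x\<bar> \<le> M"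
    using compact_imp_bounded bounded_iff by (metis imageI real_norm_def)
  \<comment> \<open>At this parameter the change of \<open>\<phi>\<close> along the ray exceeds by
    \<open>1\<close> what the bound \<open>M\<close> permits.\<close>
  define t where "t = (M + \<bar>dual_apply \<phi> x0\<bar> + 1) / \<bar>dual_apply \<phi> d\<bar>"
  have "M \<ge> 0" using M[OF halfline[of 0]] by simp
  then have t: "t \<ge> 0" by (simp add: t_def)
  have "\<bar>dual_apply \<phi> x0 + t * dual_apply \<phi> d\<bar> \<le> M"
    using M[OF halfline[OF t]] by simp
  moreover have "\<bar>t * dual_apply \<phi> d\<bar> = M + \<bar>dual_apply \<phi> x0\<bar> + 1"
    using \<phi> \<open>M \<ge> 0\<close> by (simp add: t_def abs_mult)
  ultimately show False by linarith
qed

lemma closedin_weak_seminorm_ball: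
  fixes S :: "'a::lctvs set"
  assumes "closedin weak_topology S" "closed C"
  shows "closedin weak_topology {x \<in> S. (\<Sum>\<phi>\<in>F. \<bar>dual_apply \<phi> (x - x0)\<bar>) \<in> C}"
proof -
  have "continuous_map weak_topology euclideanreal (\<lambda>x. \<bar>dual_apply \<phi> x - dual_apply \<phi> x0\<bar>)" for \<phi>
    by (intro continuous_map_real_abs continuous_map_diff continuous_map_weak_dual) auto
  then have "continuous_map weak_topology euclideanreal (\<lambda>x. \<Sum>\<phi>\<in>F. \<bar>dual_apply \<phi> (x - x0)\<bar>)"
    by (cases "finite F") (auto intro!: continuous_map_sum)
  from closedin_continuous_map_preimage[OF this, of C] have
    "closedin weak_topology (S \<inter> {x. (\<Sum>\<phi>\<in>F. \<bar>dual_apply \<phi> (x - x0)\<bar>) \<in> C})"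
    using assms by (intro closedin_Int) auto
  moreover have "S \<inter> {x. (\<Sum>\<phi>\<in>F. \<bar>dual_apply \<phi> (x - x0)\<bar>) \<in> C} =
      {x \<in> S. (\<Sum>\<phi>\<in>F. \<bar>dual_apply \<phi> (x - x0)\<bar>) \<in> C}" by blast
  ultimately show ?thesis by simp
qed

text \<open>Replaces an abstract compact neighbourhood by a closed seminorm ball, to which scaling
  along rays can be applied.\<close>

lemma locally_compact_weak_nhd:
  fixes S :: "'a::lctvs set"
  assumes lc: "locally_compact_space (subtopology weak_topology S)"
    and closed: "closedin weak_topology S" and x0: "x0 \<in> S"
  obtains F e where "finite F" "0 < e"
    "compactin weak_topology {x \<in> S. (\<Sum>\<phi>\<in>F. \<bar>dual_apply \<phi> (x - x0)\<bar>) \<le> e}"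
proof -
  obtain U K where UK: "openin (subtopology weak_topology S) U"
      "compactin (subtopology weak_topology S) K" "x0 \<in> U" "U \<subseteq> K"
    using lc x0 unfolding locally_compact_space_def by (metis IntI UNIV_I topspace_subtopology topspace_weak_topology)
  then obtain W where W: "openin weak_topology W" "U = W \<inter> S"
    by (auto simp: openin_subtopology)
  obtain F e where F: "finite F" "0 < e"
    "\<And>x. (\<Sum>\<phi>\<in>F. \<bar>dual_apply \<phi> (x - x0)\<bar>) < e \<Longrightarrow> x \<in> W"
    using weak_nhd[OF W(1), of x0] UK(3) W(2) by blast
  \<comment> \<open>Halving the radius places the closed ball inside the open one.\<close>
  have "closedin weak_topology {x \<in> S. (\<Sum>\<phi>\<in>F. \<bar>dual_apply \<phi> (x - x0)\<bar>) \<le> e / 2}"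
    using closedin_weak_seminorm_ball[OF closed, of "{..e / 2}"] by simp
  moreover have "{x \<in> S. (\<Sum>\<phi>\<in>F. \<bar>dual_apply \<phi> (x - x0)\<bar>) \<le> e / 2} \<subseteq> K"
    using F(2,3) W(2) UK(4) by force
  ultimately have "compactin weak_topology {x \<in> S. (\<Sum>\<phi>\<in>F. \<bar>dual_apply \<phi> (x - x0)\<bar>) \<le> e / 2}"
    using UK(2) by (auto simp: compactin_subtopology intro: closed_compactin)
  with F(1,2) show thesis using that[of F "e / 2"] by simp
qed

lemma convex_ray_shrink:
  assumes "convex S" "x0 \<in> S" "x0 + m *\<^sub>R d \<in> S" "0 \<le> n" "n \<le> (m::real)"
  shows "x0 + n *\<^sub>R d \<in> S"
proof (cases "m = 0")
  case False
  then have "(1 - n / m) *\<^sub>R x0 + (n / m) *\<^sub>R (x0 + m *\<^sub>R d) \<in> S"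
    using assms by (intro convexD) (auto simp: field_simps)
  then show ?thesis using False by (simp add: algebra_simps)
qed (use assms in auto)

text \<open>If no half-line issues from \<^term>\<open>x0\<close>, compactness of the unit sphere of the seminorm gives
  one factor by which every ray through that sphere leaves \<^term>\<open>S\<close>, so \<^term>\<open>S\<close> lies in a
  dilation of the compact ball.\<close>

lemma weakly_compact_if_no_halfline:
  fixes S :: "'a::lctvs set"
  assumes S: "convex S" "closedin weak_topology S" "x0 \<in> S" and e: "0 < e"
    and ball: "compactin weak_topology {x \<in> S. (\<Sum>\<phi>\<in>F. \<bar>dual_apply \<phi> (x - x0)\<bar>) \<le> e}"
    and no_halfline: "\<And>d. (\<And>t. 0 \<le> t \<Longrightarrow> x0 + t *\<^sub>R d \<in> S) \<Longrightarrow> d = 0"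
  shows "compactin weak_topology S"
proof -
  define p where "p = (\<lambda>x. \<Sum>\<phi>\<in>F. \<bar>dual_apply \<phi> x\<bar>)"
  have p_scale: "p (c *\<^sub>R x) = \<bar>c\<bar> * p x" for c x
    by (simp add: p_def abs_mult sum_distrib_left)
  define Q where "Q = {x \<in> S. p (x - x0) \<le> e}"
  have Q: "compactin weak_topology Q" using ball by (simp add: Q_def p_def)
  \<comment> \<open>Points of the sphere whose ray is still in \<open>S\<close> after the factor
    \<open>n\<close>. These closed sets decrease inside the compact ball, and a common point would
    span a half-line in \<open>S\<close>.\<close>
  define C where "C = (\<lambda>n::nat. {x \<in> S. p (x - x0) = e \<and> x0 + real n *\<^sub>R (x - x0) \<in> S})"
  have "\<exists>n. C n = {}"
  proof (rule ccontr)
    assume "\<nexists>n. C n = {}"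
    have clo: "closedin weak_topology (C n)" for n
    proof -
      have "closedin weak_topology ({x \<in> S. p (x - x0) \<in> {e}} \<inter>
          {x \<in> topspace weak_topology. x0 + real n *\<^sub>R (x - x0) \<in> S})"
        unfolding p_def
        by (intro closedin_Int closedin_weak_seminorm_ball S(2)
            closedin_continuous_map_preimage[OF continuous_map_weak_affine]) simp
      moreover have "{x \<in> S. p (x - x0) \<in> {e}} \<inter>
          {x \<in> topspace weak_topology. x0 + real n *\<^sub>R (x - x0) \<in> S} = C n"
        by (auto simp: C_def)
      ultimately show ?thesis by simp
    qed
    have "decseq C"
      unfolding decseq_def C_def using convex_ray_shrink[OF S(1,3)] by auto
    then have "(\<Inter>n. C n) \<noteq> {}"
      using \<open>\<nexists>n. C n = {}\<close> clo
      by (intro compactin_decseq_nonempty[OF Q]) (auto simp: C_def Q_def)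
    then obtain x where x: "\<And>n. x \<in> C n" by blast
    have "x - x0 = 0"
    proof (rule no_halfline)
      fix t :: real assume "0 \<le> t"
      moreover obtain n :: nat where "t \<le> real n" using real_arch_simple by blast
      ultimately show "x0 + t *\<^sub>R (x - x0) \<in> S"
        using convex_ray_shrink[OF S(1,3), of "real n"] x[of n] by (auto simp: C_def)
    qed
    then show False using x[of 0] e by (simp add: C_def p_def)
  qed
  then obtain m where m: "C m = {}" by blast
  \<comment> \<open>The successor makes the factor at least \<open>1\<close>, even if
    \<open>m\<close> is \<open>0\<close>.\<close>
  define n where "n = real (Suc m)"
  have n: "n > 0" "\<And>x. x \<in> S \<Longrightarrow> p (x - x0) = e \<Longrightarrow> x0 + n *\<^sub>R (x - x0) \<notin> S"
    using m convex_ray_shrink[OF S(1,3), of n _ "real m"] by (auto simp: n_def C_def)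
  have "S \<subseteq> (\<lambda>x. x0 + n *\<^sub>R (x - x0)) ` Q"
  proof
    fix y assume y: "y \<in> S"
    define x where "x = x0 + inverse n *\<^sub>R (y - x0)"
    have yx: "x0 + n *\<^sub>R (x - x0) = y" using n(1) by (simp add: x_def)
    have shrink: "x0 + r *\<^sub>R (x - x0) \<in> S" if "0 \<le> r" "r \<le> n" for r
      using convex_ray_shrink[OF S(1,3) _ that, of "x - x0"] y yx by simp
    have "1 \<le> n" by (simp add: n_def)
    have "x \<in> Q"
    proof (cases "p (x - x0) \<le> e")
      case True
      moreover have "x \<in> S"
        using shrink[of 1] \<open>1 \<le> n\<close> by simp
      ultimately show ?thesis by (simp add: Q_def)
    next
      case False
      \<comment> \<open>Shrinking \<open>x\<close> towards \<open>x0\<close> by \<open>r\<close>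
        hits the sphere at \<open>b\<close>. Dilating \<open>b\<close> by \<open>n\<close> yields a
        point between \<open>x0\<close> and \<open>y\<close>, hence in \<open>S\<close>, against the
        choice of \<open>n\<close>.\<close>
      define r where "r = e / p (x - x0)"
      have r: "0 < r" "r \<le> 1" using False e by (auto simp: r_def field_simps)
      define b where "b = x0 + r *\<^sub>R (x - x0)"
      have "x0 + (r * n) *\<^sub>R (x - x0) \<in> S"
        using r n(1) by (intro shrink) (simp_all add: mult_le_cancel_right1)
      then have "x0 + n *\<^sub>R (b - x0) \<in> S" by (simp add: b_def mult.commute)
      moreover have "b \<in> S"
        unfolding b_def using r \<open>1 \<le> n\<close> by (intro shrink) simp_all
      moreover have "p (b - x0) = e"
        using r False e by (simp add: b_def p_scale) (simp add: r_def)
      ultimately show ?thesis using n(2) by blast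
    qed
    then show "y \<in> (\<lambda>x. x0 + n *\<^sub>R (x - x0)) ` Q" using yx by blast
  qed
  with image_compactin[OF Q continuous_map_weak_affine] show ?thesis
    using S(2) by (rule closed_compactin)
qed

text \<open>Induction on \<open>F\<close>: the kernel of one functional in \<open>L\<close> is
  either all of \<open>L\<close> or leaves one extra dimension, spanned by some \<open>b\<close>.
  Since the projection is assembled from the functionals in \<open>F\<close>, it is continuous on
  the whole space.\<close>

lemma finite_separating_projection:
  fixes L :: "'a::lctvs set"
  assumes "finite F" "subspace L"
    and "\<And>x. x \<in> L \<Longrightarrow> (\<And>\<phi>. \<phi> \<in> F \<Longrightarrow> dual_apply \<phi> x = 0) \<Longrightarrow> x = 0"
  shows "\<exists>P. linear P \<and> continuous_on UNIV P \<and> (\<forall>x. P x \<in> L) \<and> (\<forall>x\<in>L. P x = x) \<and>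
    fin_dim_subspace L"
  using assms
proof (induction F arbitrary: L)
  case empty
  then have "L = {0}" using subspace_0 by blast
  then show ?case
    by (intro exI[of _ "\<lambda>x. 0"]) (auto simp: fin_dim_subspace_def linear_zero intro!: exI[of _ "{}"])
next
  case (insert \<phi> F)
  define L' where "L' = L \<inter> {x. dual_apply \<phi> x = 0}"
  have L': "subspace L'"
    unfolding L'_def
    by (intro subspace_inter insert.prems linear_subspace_kernel dual_apply_linear)
  have "\<exists>P. linear P \<and> continuous_on UNIV P \<and> (\<forall>x. P x \<in> L') \<and> (\<forall>x\<in>L'. P x = x) \<and>
      fin_dim_subspace L'"
    using insert.prems by (intro insert.IH L') (auto simp: L'_def)
  then obtain P B where P: "linear P" "continuous_on UNIV P" "\<And>x. P x \<in> L'"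
      "\<And>x. x \<in> L' \<Longrightarrow> P x = x" and B: "finite B" "L' = span B"
    by (auto simp: fin_dim_subspace_def)
  show ?case
  proof (cases "L' = L")
    case True
    then show ?thesis using P B by (auto simp: fin_dim_subspace_def)
  next
    case False
    then obtain b0 where b0: "b0 \<in> L" "dual_apply \<phi> b0 \<noteq> 0" by (auto simp: L'_def)
    define b where "b = inverse (dual_apply \<phi> b0) *\<^sub>R b0"
    have b: "b \<in> L" "dual_apply \<phi> b = 1"
      using b0 subspace_scale[OF insert.prems(1)] by (auto simp: b_def)
    have L'L: "x - dual_apply \<phi> x *\<^sub>R b \<in> L'" if "x \<in> L" for x
      using that b insert.prems(1) by (auto simp: L'_def subspace_diff subspace_scale)
    \<comment> \<open>Split off the component along \<open>b\<close>, measured by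
      \<open>\<phi>\<close>, project the remainder by \<open>P\<close>, and add the component
      back.\<close>
    define R where "R = (\<lambda>x. P (x - dual_apply \<phi> x *\<^sub>R b) + dual_apply \<phi> x *\<^sub>R b)"
    have "linear R"
      unfolding R_def linear_diff[OF P(1)] linear_scale[OF P(1)]
      by (intro linearI) (simp_all add: linear_add[OF P(1)] linear_scale[OF P(1)] algebra_simps)
    moreover have "continuous_on UNIV R"
      unfolding R_def
      by (intro continuous_on_add continuous_on_compose2[OF P(2)] continuous_on_diff
          continuous_on_scaleR_lctvs dual_apply_continuous continuous_on_id continuous_on_const) auto
    moreover have "R x \<in> L" for x
      unfolding R_def using P(3) b insert.prems(1)
      by (intro subspace_add subspace_scale) (auto simp: L'_def)
    moreover have "R x = x" if "x \<in> L" for x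
      unfolding R_def using P(4)[OF L'L[OF that]] by simp
    moreover have "L = span (insert b B)"
    proof
      show "L \<subseteq> span (insert b B)"
        using L'L by (auto simp: span_insert B(2)[symmetric])
      show "span (insert b B) \<subseteq> L"
        using b(1) B(2) span_superset[of B] insert.prems(1) by (intro span_minimal) (auto simp: L'_def)
    qed
    ultimately show ?thesis
      using B(1) unfolding fin_dim_subspace_def by (intro exI[of _ R]) (blast intro: finite.insertI)
  qed
qed

section \<open>Suprema of affine functions\<close>

text \<open>This is how functionals on the dual are recognised as points of the space. In the
  induction, either vanishing on \<open>F\<close> already implies vanishing at \<open>a\<close>, or
  some \<open>\<psi>\<close> vanishes on \<open>F\<close> but not at \<open>a\<close>, and
  subtracting a multiple of evaluation at \<open>a\<close> reduces to \<open>F\<close>.\<close>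

lemma functional_on_dual_eval:
  fixes g :: "'a::lctvs dual \<Rightarrow> real"
  assumes "finite F" "linear g"
    and "\<And>\<phi>. (\<And>x. x \<in> F \<Longrightarrow> dual_apply \<phi> x = 0) \<Longrightarrow> g \<phi> = 0"
  shows "\<exists>z. \<forall>\<phi>. g \<phi> = dual_apply \<phi> z"
  using assms
proof (induction F arbitrary: g)
  case empty
  then show ?case by (intro exI[of _ 0]) simp
next
  case (insert a F)
  show ?case
  proof (cases "\<exists>\<phi>. (\<forall>x\<in>F. dual_apply \<phi> x = 0) \<and> dual_apply \<phi> a \<noteq> 0")
    case False
    then show ?thesis using insert.prems by (intro insert.IH) auto
  next
    case True
    then obtain \<psi> where \<psi>: "\<And>x. x \<in> F \<Longrightarrow> dual_apply \<psi> x = 0" "dual_apply \<psi> a \<noteq> 0" by blast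
    define c where "c = g \<psi> / dual_apply \<psi> a"
    have "\<exists>z. \<forall>\<phi>. g \<phi> - dual_apply \<phi> a * c = dual_apply \<phi> z"
    proof (rule insert.IH)
      show "linear (\<lambda>\<phi>. g \<phi> - dual_apply \<phi> a * c)"
        using linear_add[OF insert.prems(1)] linear_scale[OF insert.prems(1)]
        by (intro linearI) (auto simp: algebra_simps)
    next
      fix \<phi> assume \<phi>: "\<And>x. x \<in> F \<Longrightarrow> dual_apply \<phi> x = 0"
      have "g (\<phi> - (dual_apply \<phi> a / dual_apply \<psi> a) *\<^sub>R \<psi>) = 0"
        using \<phi> \<psi> by (intro insert.prems(2)) auto
      then show "g \<phi> - dual_apply \<phi> a * c = 0"
        by (simp add: linear_diff[OF insert.prems(1)] linear_scale[OF insert.prems(1)] c_def)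
    qed
    then obtain z where "\<And>\<phi>. g \<phi> - dual_apply \<phi> a * c = dual_apply \<phi> z" by blast
    then have "g \<phi> = dual_apply \<phi> (z + c *\<^sub>R a)" for \<phi>
      by (simp add: mult.commute diff_eq_eq)
    then show ?thesis by blast
  qed
qed

section \<open>Level sets, minimizers and the closed convex hull\<close>

context
  fixes C :: "('a::lctvs dual \<times> real) set" and h :: "'a \<Rightarrow> ereal" and m :: real
  assumes level: "\<And>x r. h x \<le> ereal r \<longleftrightarrow> (\<forall>p\<in>C. dual_apply (fst p) x - snd p \<le> r)"
    and inf: "(INF x. h x) = ereal m"
begin

lemma sup_affine_ge_inf: "h x \<le> ereal r \<Longrightarrow> m \<le> r"
  using INF_lower[of x UNIV h] inf order_trans by fastforce

lemma sup_affine_level_nonempty: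
  assumes "m < r"
  obtains x where "h x \<le> ereal r"
proof -
  have "(INF x. h x) < ereal r" using inf assms by simp
  then show thesis using that by (auto simp: INF_less_iff intro: less_imp_le)
qed

lemma sup_affine_level_eq:
  "{x. h x \<le> ereal r} = (\<Inter>p\<in>C. {x. dual_apply (fst p) x \<le> r + snd p})"
  by (auto simp: level algebra_simps)

lemma convex_sup_affine_level: "convex {x. h x \<le> ereal r}"
proof -
  have "convex {x. dual_apply \<phi> x \<le> c}" for \<phi> :: "'a dual" and c
    using convex_linear_vimage[OF dual_apply_linear convex_real_interval(2)[of c], of \<phi>]
    by (simp add: vimage_def)
  then show ?thesis unfolding sup_affine_level_eq by (intro convex_INT) auto
qed

lemma closedin_sup_affine_level: "closedin weak_topology {x. h x \<le> ereal r}"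
\<comment> \<open>Closedness of an intersection is available for nonempty families; with
  \<open>C\<close> empty the level set is the whole space.\<close>
proof (cases "C = {}")
  case False
  then show ?thesis
    unfolding sup_affine_level_eq by (intro closedin_INT closedin_weak_halfspace) auto
next
  case True
  then show ?thesis
    using closedin_topspace[of "weak_topology :: 'a topology"] by (simp add: level)
qed

text \<open>For fixed \<open>x\<close> and \<open>r\<close> the inequality defines a closed
  half-space of pairs, and it contains \<open>C\<close>.\<close>

lemma closure_hull_minorant:
  assumes "p \<in> closure (convex hull C)" "h x \<le> ereal r"
  shows "dual_apply (fst p) x - snd p \<le> r"
proof -
  let ?H = "{p::'a dual \<times> real. dual_apply (fst p) x - snd p \<le> r}"
  have "linear (\<lambda>p::'a dual \<times> real. dual_apply (fst p) x - snd p)"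
    by (intro linearI) (auto simp: algebra_simps)
  from convex_linear_vimage[OF this convex_real_interval(2)[of r]]
  have "convex ?H" by (simp add: vimage_def)
  moreover have "C \<subseteq> ?H" using assms(2) by (auto simp: level)
  moreover have "closed ?H"
    by (intro closed_Collect_le continuous_intros
        continuous_on_compose2[OF continuous_on_dual_eval]) auto
  ultimately have "closure (convex hull C) \<subseteq> ?H"
    by (intro closure_minimal hull_minimal) auto
  then show ?thesis using assms(1) by blast
qed

text \<open>Every element of \<^term>\<open>fst ` C\<close> is nonpositive at a recession direction, hence so is the closed
  cone, which by hypothesis also contains the negatives of these elements.\<close>

lemma recession_direction_constancy:
  assumes sub: "subspace (closed_cone (convex hull (fst ` C)))"
    and ray: "\<And>t. 0 \<le> t \<Longrightarrow> h (x + t *\<^sub>R d) \<le> ereal r" and p: "p \<in> C"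
  shows "dual_apply (fst p) d = 0"
proof -
  have nonpos: "dual_apply (fst q) d \<le> 0" if q: "q \<in> C" for q
  proof (rule ccontr)
    assume neg: "\<not> dual_apply (fst q) d \<le> 0"
    define t where "t = (\<bar>r + snd q - dual_apply (fst q) x\<bar> + 1) / dual_apply (fst q) d"
    have "0 \<le> t" using neg by (simp add: t_def)
    from ray[OF this] q have "dual_apply (fst q) x + t * dual_apply (fst q) d - snd q \<le> r"
      by (auto simp: level)
    moreover have "t * dual_apply (fst q) d = \<bar>r + snd q - dual_apply (fst q) x\<bar> + 1"
      using neg by (simp add: t_def)
    ultimately show False by linarith
  qed
  let ?H = "{\<phi>::'a dual. dual_apply \<phi> d \<le> 0}"
  have "linear (\<lambda>\<phi>::'a dual. dual_apply \<phi> d)" by (intro linearI) auto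
  from convex_linear_vimage[OF this convex_real_interval(2)[of 0]]
  have "convex ?H" by (simp add: vimage_def)
  then have "convex hull (fst ` C) \<subseteq> ?H"
    using nonpos by (intro hull_minimal) auto
  then have "cone hull (insert 0 (convex hull (fst ` C))) \<subseteq> ?H"
    by (intro hull_minimal) (auto simp: cone_def mult_nonneg_nonpos)
  moreover have "closed ?H"
    by (intro closed_Collect_le continuous_on_dual_eval continuous_on_const)
  ultimately have H: "closed_cone (convex hull (fst ` C)) \<subseteq> ?H"
    unfolding closed_cone_def by (rule closure_minimal)
  have "fst p \<in> convex hull (fst ` C)" using p by (auto intro: hull_inc)
  then have "fst p \<in> closed_cone (convex hull (fst ` C))"
    unfolding closed_cone_def using closure_subset hull_subset[of "insert 0 (convex hull (fst ` C))" cone]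
    by blast
  then have "- fst p \<in> ?H" using subspace_neg[OF sub] H by blast
  then show ?thesis using nonpos[OF p] by simp
qed

text \<open>All level sets are invariant under \<open>L\<close>, so each is its slice by the kernel
  \<open>M\<close> of a projection onto \<open>L\<close>, plus \<open>L\<close>. In the slice no
  half-line is left, and compactness gives both a minimizer and the set \<open>K\<close>.\<close>

lemma argmin_decomposition:
  assumes lc: "weakly_inf_locally_compact h"
    and sub: "subspace (closed_cone (convex hull (fst ` C)))"
  shows "\<exists>K L. K \<noteq> {} \<and> convex K \<and> compactin weak_topology K \<and> fin_dim_subspace L \<and>
    {x. h x \<le> ereal m} = K + L"
proof -
  define S where "S = (\<lambda>r. {x. h x \<le> ereal r})"
  define L where "L = {d. \<forall>p\<in>C. dual_apply (fst p) d = 0}"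
  have L: "subspace L" unfolding L_def by (rule subspaceI) auto
  have invariant: "x + d \<in> S r \<longleftrightarrow> x \<in> S r" if "d \<in> L" for x d r
    using that by (simp add: S_def level L_def)
  have closed: "closedin weak_topology (S r)" for r
    unfolding S_def by (rule closedin_sup_affine_level)
  have lcS: "locally_compact_space (subtopology weak_topology (S r))" for r
    using lc by (simp add: weakly_inf_locally_compact_def S_def)
  obtain x0 where x0: "x0 \<in> S (m + 1)"
    using sup_affine_level_nonempty[of "m + 1"] by (auto simp: S_def)
  obtain F e where F: "finite F" "0 < e"
    "compactin weak_topology {x \<in> S (m + 1). (\<Sum>\<phi>\<in>F. \<bar>dual_apply \<phi> (x - x0)\<bar>) \<le> e}"
    by (rule locally_compact_weak_nhd[OF lcS closed x0])
  \<comment> \<open>On a direction of \<open>L\<close> where \<open>F\<close> vanishes the seminorm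
    stays \<open>0\<close>, so the ray through \<open>x0\<close> remains in the compact ball. Thus
    \<open>F\<close> separates the points of \<open>L\<close>.\<close>
  have "d = 0" if d: "d \<in> L" "\<And>\<phi>. \<phi> \<in> F \<Longrightarrow> dual_apply \<phi> d = 0" for d
  proof (rule weakly_compact_no_halfline[OF F(3), of x0])
    fix t :: real
    have "x0 + t *\<^sub>R d \<in> S (m + 1)"
      using x0 invariant[OF subspace_scale[OF L d(1)]] by blast
    then show "x0 + t *\<^sub>R d \<in> {x \<in> S (m + 1). (\<Sum>\<phi>\<in>F. \<bar>dual_apply \<phi> (x - x0)\<bar>) \<le> e}"
      using d(2) F(2) by simp
  qed
  then obtain P where P: "linear P" "continuous_on UNIV P" "\<And>x. P x \<in> L" "\<And>x. x \<in> L \<Longrightarrow> P x = x"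
    and fin: "fin_dim_subspace L"
    using finite_separating_projection[OF F(1) L] by blast
  define M where "M = {x. P x = 0}"
  have M_closed: "closedin weak_topology M"
    using closedin_continuous_map_preimage[OF continuous_map_weak_linear[OF P(1,2)] closedin_weak_zero]
    by (simp add: M_def)
  have reduce: "x - P x \<in> S r \<inter> M" if "x \<in> S r" for x r
    using that invariant[of "- P x" x r] subspace_neg[OF L] P(3,4)
    by (simp add: M_def linear_diff[OF P(1)])
  define D where "D = S (m + 1) \<inter> M"
  have convex: "convex (S r \<inter> M)" for r
    unfolding S_def M_def
    by (intro convex_Int convex_sup_affine_level subspace_imp_convex linear_subspace_kernel P(1))
  have D_closed: "closedin weak_topology D"
    unfolding D_def by (intro closedin_Int closed M_closed)
  have D_compact: "compactin weak_topology D"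
  proof -
    define x1 where "x1 = x0 - P x0"
    have x1: "x1 \<in> S (m + 1)" "x1 \<in> D"
      using reduce[OF x0] by (auto simp: x1_def D_def)
    \<comment> \<open>A new seminorm ball, centred at a point of \<open>D\<close>; the earlier
      \<open>F\<close> and \<open>e\<close> belong to \<open>x0\<close>, which may lie outside
      \<open>M\<close>.\<close>
    obtain F e where F: "finite F" "0 < e"
      "compactin weak_topology {x \<in> S (m + 1). (\<Sum>\<phi>\<in>F. \<bar>dual_apply \<phi> (x - x1)\<bar>) \<le> e}"
      by (rule locally_compact_weak_nhd[OF lcS closed x1(1)])
    have "closedin weak_topology {x \<in> D. (\<Sum>\<phi>\<in>F. \<bar>dual_apply \<phi> (x - x1)\<bar>) \<in> {..e}}"
      by (intro closedin_weak_seminorm_ball D_closed) simp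
    then have ball: "compactin weak_topology {x \<in> D. (\<Sum>\<phi>\<in>F. \<bar>dual_apply \<phi> (x - x1)\<bar>) \<le> e}"
      by (intro closed_compactin[OF F(3)]) (auto simp: D_def)
    show ?thesis
    proof (rule weakly_compact_if_no_halfline[OF _ D_closed x1(2) F(2) ball])
      show "convex D" unfolding D_def by (rule convex)
      fix d assume d: "\<And>t. 0 \<le> t \<Longrightarrow> x1 + t *\<^sub>R d \<in> D"
      have "d \<in> L"
        using recession_direction_constancy[OF sub, of x1 d "m + 1"] d
        by (auto simp: L_def D_def S_def)
      moreover have "P d = 0"
        using d[of 0] d[of 1] by (simp add: D_def M_def linear_add[OF P(1)])
      ultimately show "d = 0" using P(4) by simp
    qed
  qed
  define K where "K = S m \<inter> M"
  have "K \<noteq> {}"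
  proof -
    \<comment> \<open>Slices of levels decreasing to \<open>m\<close>. The offsets are at most
      \<open>1\<close>, so all slices lie in the compact set \<open>D\<close>, and a common point
      attains the infimum.\<close>
    define E where "E = (\<lambda>n. S (m + inverse (real (Suc n))) \<inter> M)"
    have mono: "S r \<subseteq> S r'" if "r \<le> r'" for r r'
      using that by (auto simp: S_def intro: order_trans)
    have "(\<Inter>n. E n) \<noteq> {}"
    proof (rule compactin_decseq_nonempty[OF D_compact])
      fix n
      show "closedin weak_topology (E n)" unfolding E_def by (intro closedin_Int closed M_closed)
      have "inverse (real (Suc n)) \<le> 1" by (simp add: field_simps)
      then show "E n \<subseteq> D" unfolding E_def D_def by (intro Int_mono mono) simp_all
      obtain y where "y \<in> S (m + inverse (real (Suc n)))"
        using sup_affine_level_nonempty[of "m + inverse (real (Suc n))"] by (auto simp: S_def)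
      then show "E n \<noteq> {}" using reduce by (auto simp: E_def)
      show "decseq E"
        unfolding decseq_def E_def
        by (intro allI impI Int_mono mono) (auto simp: le_imp_inverse_le)
    qed
    then obtain x where x: "\<And>n. x \<in> E n" by blast
    have "dual_apply (fst p) x - snd p \<le> m" if "p \<in> C" for p
    proof (rule field_le_epsilon)
      fix \<epsilon> :: real assume "0 < \<epsilon>"
      then obtain n where "inverse (real (Suc n)) < \<epsilon>" using reals_Archimedean by blast
      moreover have "dual_apply (fst p) x - snd p \<le> m + inverse (real (Suc n))"
        using x[of n] that by (simp add: E_def S_def level)
      ultimately show "dual_apply (fst p) x - snd p \<le> m + \<epsilon>" by linarith
    qed
    then have "x \<in> K" using x[of 0] by (auto simp: K_def S_def level E_def)
    then show ?thesis by blast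
  qed
  moreover have "convex K" unfolding K_def by (rule convex)
  moreover have "compactin weak_topology K"
    unfolding K_def
    by (rule closed_compactin[OF D_compact _ closedin_Int[OF closed M_closed]])
      (auto simp: D_def S_def intro: order_trans)
  moreover have "S m = K + L"
  proof
    show "S m \<subseteq> K + L"
    proof
      fix y assume "y \<in> S m"
      from set_plus_intro[OF _ P(3), of "y - P y" K y] reduce[OF this] show "y \<in> K + L"
        by (simp add: K_def)
    qed
    show "K + L \<subseteq> S m"
      using invariant by (auto simp: K_def elim!: set_plus_elim)
  qed
  ultimately show ?thesis using fin by (auto simp: S_def)
qed

text \<open>A functional on \<^typ>\<open>'a dual \<times> real\<close> strictly separating the point from \<^term>\<open>C\<close> is given by a
  point of \<^typ>\<open>'a\<close> and a slope. If the hyperplane is not vertical, \<^term>\<open>h\<close> would go below its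
  infimum at a multiple of that point; if it is vertical, \<^term>\<open>h\<close> would tend to minus infinity in
  that direction.\<close>

lemma neg_inf_mem_closure_hull:
  assumes ne: "C \<noteq> {}" and up: "\<And>\<phi> s t. (\<phi>, s) \<in> C \<Longrightarrow> s \<le> t \<Longrightarrow> (\<phi>, t) \<in> C"
  shows "(0, - m) \<in> closure (convex hull C)"
proof (rule ccontr)
  assume "(0, - m) \<notin> closure (convex hull C)"
  then have "(0, - m) \<in> - closure (convex hull C)" by simp
  then obtain A B where AB: "open A" "open B" "0 \<in> A" "- m \<in> B" "A \<times> B \<subseteq> - closure (convex hull C)"
    using open_prod_elim[OF open_Compl[OF closed_closure]] by (metis mem_Sigma_iff)
  obtain F e1 where F: "finite F" "0 < e1"
    "\<And>\<phi>. (\<Sum>x\<in>F. \<bar>dual_apply (\<phi> - 0) x\<bar>) < e1 \<Longrightarrow> \<phi> \<in> A"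
    by (rule weak_star_nhd[OF AB(1,3)]) blast
  obtain e2 where e2: "0 < e2" "ball (- m) e2 \<subseteq> B"
    using AB(2,4) open_contains_ball by blast
  \<comment> \<open>A seminorm whose ball of radius \<open>e\<close>, moved to
    \<open>(0, - m)\<close>, fits into \<open>A \<times> B\<close>. It involves only evaluations on
    \<open>F\<close>, so the separating functional will be controlled by these.\<close>
  define q where "q = (\<lambda>p::'a dual \<times> real. (\<Sum>x\<in>F. \<bar>dual_apply (fst p) x\<bar>) + \<bar>snd p\<bar>)"
  have q_add: "q (p + p') \<le> q p + q p'" for p p'
    unfolding q_def by (simp add: sum.distrib[symmetric] algebra_simps)
      (smt (verit) abs_triangle_ineq sum_mono sum.distrib)
  have q_scale: "q (c *\<^sub>R p) = \<bar>c\<bar> * q p" for c p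
    by (simp add: q_def abs_mult sum_distrib_left distrib_left)
  have q_nonneg: "0 \<le> q p" for p
    by (simp add: q_def sum_nonneg)
  define e where "e = min e1 e2"
  have e: "0 < e" "e \<le> e1" "e \<le> e2" using F(2) e2(1) by (auto simp: e_def)
  define V where "V = {p. q p < e}"
  have V: "convex V"
  proof (rule convexI)
    fix p p' and u v :: real
    assume *: "p \<in> V" "p' \<in> V" "0 \<le> u" "0 \<le> v" "u + v = 1"
    have "q (u *\<^sub>R p + v *\<^sub>R p') \<le> u * q p + v * q p'"
      using q_add[of "u *\<^sub>R p" "v *\<^sub>R p'"] * by (simp add: q_scale)
    also have "\<dots> < e" using * by (intro convex_bound_lt) (auto simp: V_def)
    finally show "u *\<^sub>R p + v *\<^sub>R p' \<in> V" by (simp add: V_def)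
  qed
  have symmetric: "- p \<in> V" if "p \<in> V" for p
    using that q_scale[of "- 1" p] by (simp add: V_def)
  have absorbing: "\<exists>t>0. t *\<^sub>R p \<in> V" for p
    using e(1) q_nonneg[of p]
    by (intro exI[of _ "e / (q p + 1)"]) (auto simp: V_def q_scale field_simps add_nonneg_pos)
  have disjoint: "p - (0, - m) \<notin> V" if p: "p \<in> convex hull C" for p
  proof
    assume "p - (0, - m) \<in> V"
    then have "(\<Sum>x\<in>F. \<bar>dual_apply (fst p) x\<bar>) + \<bar>snd p + m\<bar> < e"
      by (simp add: V_def q_def)
    moreover have "0 \<le> (\<Sum>x\<in>F. \<bar>dual_apply (fst p) x\<bar>)" by (intro sum_nonneg) simp
    ultimately have small: "(\<Sum>x\<in>F. \<bar>dual_apply (fst p) x\<bar>) < e1" "\<bar>snd p + m\<bar> < e2"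
      using e by linarith+
    have "fst p \<in> A" using F(3)[of "fst p"] small(1) by simp
    moreover have "snd p \<in> ball (- m) e2" using small(2) by (simp add: dist_real_def)
    ultimately have "p \<in> A \<times> B" using e2(2) by (auto simp: mem_Times_iff)
    then show False using AB(5) p closure_subset by blast
  qed
  have "convex hull C \<noteq> {}" using ne by simp
  then obtain G \<epsilon> where G: "linear G" "0 < \<epsilon>" "\<And>p. p \<in> convex hull C \<Longrightarrow> G p \<le> G (0, - m) - \<epsilon>"
      "\<And>v. v \<in> V \<Longrightarrow> \<bar>G v\<bar> \<le> (1::real)"
    using algebraic_separation[OF convex_convex_hull _ V symmetric absorbing disjoint] by blast
  define g where "g = (\<lambda>\<phi>. G (\<phi>, 0))"
  define c where "c = G (0, 1)"
  have Gsplit: "G (\<phi>, t) = g \<phi> + t * c" for \<phi> t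
  proof -
    have "G (\<phi>, t) = G ((\<phi>, 0) + t *\<^sub>R (0, 1))" by simp
    also have "\<dots> = g \<phi> + t * c"
      by (simp only: linear_add[OF G(1)] linear_scale[OF G(1)] g_def c_def real_scaleR_def)
    finally show ?thesis .
  qed
  have g: "linear g"
    using linear_compose[OF _ G(1), of "\<lambda>y. (y, 0)"]
    by (simp add: g_def o_def linear_iff)
  have "g \<phi> = 0" if \<phi>: "\<And>x. x \<in> F \<Longrightarrow> dual_apply \<phi> x = 0" for \<phi>
  proof (rule ccontr)
    assume "g \<phi> \<noteq> 0"
    \<comment> \<open>The seminorm vanishes on this vector, yet the functional takes the value
      \<open>2\<close> on it.\<close>
    have "(2 / g \<phi>) *\<^sub>R (\<phi>, 0) \<in> V" using \<phi> e(1) by (simp add: V_def q_def)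
    from G(4)[OF this] have "\<bar>(2 / g \<phi>) * g \<phi>\<bar> \<le> 1"
      by (simp only: linear_scale[OF G(1)] g_def real_scaleR_def)
    then show False using \<open>g \<phi> \<noteq> 0\<close> by simp
  qed
  then obtain z where z: "\<And>\<phi>. g \<phi> = dual_apply \<phi> z"
    using functional_on_dual_eval[OF F(1) g] by blast
  have sep: "dual_apply \<phi> z + s * c \<le> - m * c - \<epsilon>" if "(\<phi>, s) \<in> C" for \<phi> s
    using G(3)[OF hull_inc[OF that]] by (simp add: Gsplit z)
  have "c \<le> 0"
  proof (rule ccontr)
    assume c: "\<not> c \<le> 0"
    obtain \<phi> s where \<phi>: "(\<phi>, s) \<in> C" using ne by auto
    define t where "t = max s ((- m * c - dual_apply \<phi> z) / c)"
    have "(\<phi>, t) \<in> C" by (rule up[OF \<phi>]) (simp add: t_def)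
    from sep[OF this] have "t * c \<le> - m * c - dual_apply \<phi> z - \<epsilon>" by simp
    moreover have "(- m * c - dual_apply \<phi> z) / c * c \<le> t * c"
      using c by (intro mult_right_mono) (auto simp: t_def)
    ultimately show False using c G(2) by simp
  qed
  show False
  proof (cases "c = 0")
    case True
    obtain x where x: "h x \<le> ereal (m + 1)" using sup_affine_level_nonempty[of "m + 1"] by auto
    \<comment> \<open>With zero slope every functional in \<open>C\<close> is at most
      \<open>- \<epsilon>\<close> at \<open>z\<close>; the factor \<open>2 / \<epsilon>\<close>
      lowers the level from \<open>m + 1\<close> to \<open>m - 1\<close>.\<close>
    have "h (x + (2 / \<epsilon>) *\<^sub>R z) \<le> ereal (m - 1)"
      unfolding level
    proof
      fix p assume p: "p \<in> C"
      then have "dual_apply (fst p) z \<le> - \<epsilon>" using sep[of "fst p" "snd p"] True by simp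
      then have "(2 / \<epsilon>) * dual_apply (fst p) z \<le> (2 / \<epsilon>) * (- \<epsilon>)"
        using G(2) by (intro mult_left_mono) auto
      moreover have "(2 / \<epsilon>) * (- \<epsilon>) = - 2" using G(2) by simp
      moreover have "dual_apply (fst p) x - snd p \<le> m + 1" using x p by (simp add: level)
      moreover have "dual_apply (fst p) (x + (2 / \<epsilon>) *\<^sub>R z)
          = dual_apply (fst p) x + (2 / \<epsilon>) * dual_apply (fst p) z" by simp
      ultimately show "dual_apply (fst p) (x + (2 / \<epsilon>) *\<^sub>R z) - snd p \<le> m - 1" by linarith
    qed
    from sup_affine_ge_inf[OF this] show False by simp
  next
    case False
    then have c: "c < 0" using \<open>c \<le> 0\<close> by simp
    \<comment> \<open>Dividing the separation inequality by the positive number \<open>- c\<close>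
      makes \<open>z\<close> a point where \<open>h\<close> is below its infimum.\<close>
    have "h (inverse (- c) *\<^sub>R z) \<le> ereal (m - \<epsilon> / (- c))"
      unfolding level
    proof
      fix p assume "p \<in> C"
      then have "(dual_apply (fst p) z + snd p * c) / (- c) \<le> (- m * c - \<epsilon>) / (- c)"
        using sep[of "fst p" "snd p"] c by (intro divide_right_mono) auto
      then show "dual_apply (fst p) (inverse (- c) *\<^sub>R z) - snd p \<le> m - \<epsilon> / (- c)"
        using c by (simp add: add_divide_distrib diff_divide_distrib inverse_eq_divide)
    qed
    from sup_affine_ge_inf[OF this] show False
      using divide_pos_neg[OF G(2) c] by simp
  qed
qed

end

section \<open>Robust sums\<close>

text \<open>Tests a bound on an extended real sum by strict real lower bounds of the summands. This
  is the form in which affine minorants, found for each summand separately, bound the sum.\<close>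

lemma ereal_sum_le_real:
  fixes F :: "'b \<Rightarrow> ereal"
  assumes "finite J" "\<And>j. j \<in> J \<Longrightarrow> F j \<noteq> -\<infinity>"
    and "\<And>a. (\<And>j. j \<in> J \<Longrightarrow> ereal (a j) < F j) \<Longrightarrow> (\<Sum>j\<in>J. a j) \<le> r"
  shows "(\<Sum>j\<in>J. F j) \<le> ereal r"
  using assms
proof (induction J arbitrary: r)
  case empty
  then show ?case by simp
next
  case (insert k J)
  have le: "(\<Sum>j\<in>J. F j) \<le> ereal (r - b)" if b: "ereal b < F k" for b
  proof (rule insert.IH)
    fix a assume a: "\<And>j. j \<in> J \<Longrightarrow> ereal (a j) < F j"
    have "(\<Sum>j\<in>insert k J. (a(k := b)) j) \<le> r"
      using a b by (intro insert.prems(2)) auto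
    moreover have "(\<Sum>j\<in>J. (a(k := b)) j) = (\<Sum>j\<in>J. a j)"
      using insert.hyps(2) by (intro sum.cong) auto
    ultimately show "(\<Sum>j\<in>J. a j) \<le> r - b"
      using insert.hyps by simp
  qed (use insert.prems(1) in auto)
  obtain b where b: "ereal b < F k"
    using insert.prems(1)[of k] ereal_dense2[of "-\<infinity>" "F k"] by auto
  have "(\<Sum>j\<in>J. F j) \<noteq> -\<infinity>"
  proof
    assume sum: "(\<Sum>j\<in>J. F j) = -\<infinity>"
    then have "\<bar>\<Sum>j\<in>J. F j\<bar> = \<infinity>" by simp
    then have "\<exists>j\<in>J. \<bar>F j\<bar> = \<infinity>" by (rule sum_Inf[THEN iffD1, THEN conjunct2])
    then obtain j where j: "j \<in> J" "\<bar>F j\<bar> = \<infinity>" ..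
    have "F j \<noteq> -\<infinity>" using j(1) by (intro insert.prems(1)) simp
    then have "F j = \<infinity>" using j(2) by (cases "F j") simp_all
    then have "(\<Sum>j\<in>J. F j) = \<infinity>"
      unfolding sum_Pinfty using insert.hyps(1) j(1) by blast
    then show False using sum by simp
  qed
  \<comment> \<open>Infinity is excluded by the bound \<open>r - b\<close>, so the remaining sum is
    real and may be subtracted.\<close>
  then obtain c where c: "(\<Sum>j\<in>J. F j) = ereal c"
    using le[OF b] by (cases "\<Sum>j\<in>J. F j") auto
  have "F k \<le> ereal (r - c)"
  proof (rule ccontr)
    assume "\<not> F k \<le> ereal (r - c)"
    then obtain b where "ereal (r - c) < ereal b" "ereal b < F k"
      using ereal_dense2 by (metis not_le)
    then show False using le[of b] c by simp
  qed
  then have "F k + (\<Sum>j\<in>J. F j) \<le> ereal (r - c) + ereal c"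
    unfolding c by (rule add_right_mono)
  then show ?case using insert.hyps by simp
qed

section \<open>Minkowski sums of epigraphs of conjugates\<close>

lemma mem_sum_epi_conjugate_iff:
  assumes "finite J"
  shows "(\<phi>, s) \<in> (\<Sum>j\<in>J. epi (conjugate (f j))) \<longleftrightarrow>
    (\<exists>\<xi> t. (\<forall>j\<in>J. conjugate (f j) (\<xi> j) \<le> ereal (t j)) \<and> \<phi> = (\<Sum>j\<in>J. \<xi> j) \<and> s = (\<Sum>j\<in>J. t j))"
    (is "?lhs \<longleftrightarrow> ?rhs")
proof
  assume ?lhs
  then obtain p where p: "\<forall>j\<in>J. p j \<in> epi (conjugate (f j))" "(\<phi>, s) = sum p J"
    by (auto simp: set_sum_alt[OF assms])
  then have "\<phi> = (\<Sum>j\<in>J. fst (p j))" "s = (\<Sum>j\<in>J. snd (p j))"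
    by (metis fst_conv fst_sum, metis snd_conv snd_sum)
  moreover have "\<forall>j\<in>J. conjugate (f j) (fst (p j)) \<le> ereal (snd (p j))"
    using p(1) by (auto simp: epi_def split: prod.splits)
  ultimately show ?rhs
    by (intro exI[of _ "\<lambda>j. fst (p j)"] exI[of _ "\<lambda>j. snd (p j)"]) simp
next
  assume ?rhs
  then obtain \<xi> t where *: "\<forall>j\<in>J. conjugate (f j) (\<xi> j) \<le> ereal (t j)"
      "\<phi> = (\<Sum>j\<in>J. \<xi> j)" "s = (\<Sum>j\<in>J. t j)" by blast
  have "(\<phi>, s) = (\<Sum>j\<in>J. (\<xi> j, t j))"
    using *(2,3) by (simp add: sum_prod)
  then show ?lhs using *(1) unfolding set_sum_alt[OF assms] by (auto simp: epi_def)
qed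

text \<open>Links the subspace hypothesis, stated for domains, with the pairs in the epigraph
  sums.\<close>

lemma fst_image_sum_epi_conjugate:
  assumes "finite J"
  shows "fst ` (\<Sum>j\<in>J. epi (conjugate (f j))) = (\<Sum>j\<in>J. eff_dom (conjugate (f j)))"
proof (intro set_eqI iffI)
  fix \<phi> assume "\<phi> \<in> fst ` (\<Sum>j\<in>J. epi (conjugate (f j)))"
  then obtain \<xi> t where "\<forall>j\<in>J. conjugate (f j) (\<xi> j) \<le> ereal (t j)" "\<phi> = (\<Sum>j\<in>J. \<xi> j)"
    by (auto simp: mem_sum_epi_conjugate_iff[OF assms])
  then show "\<phi> \<in> (\<Sum>j\<in>J. eff_dom (conjugate (f j)))"
    unfolding set_sum_alt[OF assms] by (fastforce simp: eff_dom_def intro: le_less_trans)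
next
  fix \<phi> assume "\<phi> \<in> (\<Sum>j\<in>J. eff_dom (conjugate (f j)))"
  then obtain \<xi> where \<xi>: "\<forall>j\<in>J. conjugate (f j) (\<xi> j) < \<infinity>" "\<phi> = (\<Sum>j\<in>J. \<xi> j)"
    by (auto simp: set_sum_alt[OF assms] eff_dom_def)
  \<comment> \<open>A real upper bound exists also for the value minus infinity, so no properness
    enters here.\<close>
  have "\<exists>t. c < \<infinity> \<longrightarrow> c \<le> ereal t" for c :: ereal
    by (cases c) auto
  then obtain t where "\<And>c. c < \<infinity> \<Longrightarrow> c \<le> ereal (t c)" by metis
  then have "(\<phi>, \<Sum>j\<in>J. t (conjugate (f j) (\<xi> j))) \<in> (\<Sum>j\<in>J. epi (conjugate (f j)))"
    unfolding mem_sum_epi_conjugate_iff[OF assms]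
    using \<xi> by (intro exI[of _ \<xi>] exI[of _ "\<lambda>j. t (conjugate (f j) (\<xi> j))"]) auto
  then show "\<phi> \<in> fst ` (\<Sum>j\<in>J. epi (conjugate (f j)))" by force
qed

text \<open>The surplus \<open>r - s\<close> is put on a single index \<open>k\<close>, which exists
  as \<open>J\<close> is nonempty.\<close>

lemma sum_epi_conjugate_upward:
  assumes J: "J \<in> fin_subsets I" and mem: "(\<phi>, s) \<in> (\<Sum>j\<in>J. epi (conjugate (f j)))" and "s \<le> r"
  shows "(\<phi>, r) \<in> (\<Sum>j\<in>J. epi (conjugate (f j)))"
proof -
  have fin: "finite J" and "J \<noteq> {}" using J by (auto simp: fin_subsets_def)
  then obtain k where k: "k \<in> J" by blast
  obtain \<xi> t where *: "\<forall>j\<in>J. conjugate (f j) (\<xi> j) \<le> ereal (t j)"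
      "\<phi> = (\<Sum>j\<in>J. \<xi> j)" "s = (\<Sum>j\<in>J. t j)"
    using mem by (auto simp: mem_sum_epi_conjugate_iff[OF fin])
  define t' where "t' = (\<lambda>j. t j + (if j = k then r - s else 0))"
  have "(\<Sum>j\<in>J. t' j) = s + (r - s)"
    unfolding t'_def sum.distrib *(3) using fin k by (simp add: sum.delta)
  then have "r = (\<Sum>j\<in>J. t' j)" by simp
  moreover have "\<forall>j\<in>J. conjugate (f j) (\<xi> j) \<le> ereal (t' j)"
    using *(1) \<open>s \<le> r\<close> by (auto simp: t'_def intro: order_trans)
  ultimately show ?thesis
    unfolding mem_sum_epi_conjugate_iff[OF fin] using *(2) by blast
qed

lemma conjugate_neq_MInfty:
  assumes "proper f"
  shows "conjugate f \<phi> \<noteq> -\<infinity>"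
proof
  assume *: "conjugate f \<phi> = -\<infinity>"
  obtain x where x: "f x \<noteq> \<infinity>" using assms by (auto simp: proper_def)
  have "ereal (dual_apply \<phi> x) - f x \<le> -\<infinity>"
    using * SUP_upper[of x UNIV "\<lambda>x. ereal (dual_apply \<phi> x) - f x"] by (simp add: conjugate_def)
  then show False using x by (cases "f x") auto
qed

text \<open>Properness keeps the conjugates above minus infinity, so a real bound on the finite sum
  makes every summand real. The summands then serve as heights, and upward closure supplies the
  rest.\<close>

lemma sum_conjugate_le_iff:
  assumes J: "J \<in> fin_subsets I" and proper: "\<And>j. j \<in> J \<Longrightarrow> proper (f j)"
  shows "(\<phi>, s) \<in> (\<Sum>j\<in>J. epi (conjugate (f j))) \<longleftrightarrow>
    (\<exists>\<xi>. (\<Sum>j\<in>J. \<xi> j) = \<phi> \<and> (\<Sum>j\<in>J. conjugate (f j) (\<xi> j)) \<le> ereal s)"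
    (is "?lhs \<longleftrightarrow> ?rhs")
proof
  have fin: "finite J" using J by (simp add: fin_subsets_def)
  show ?rhs if ?lhs
  proof -
    obtain \<xi> t where *: "\<And>j. j \<in> J \<Longrightarrow> conjugate (f j) (\<xi> j) \<le> ereal (t j)"
        "\<phi> = (\<Sum>j\<in>J. \<xi> j)" "s = (\<Sum>j\<in>J. t j)"
      using \<open>?lhs\<close> by (auto simp: mem_sum_epi_conjugate_iff[OF fin])
    have "(\<Sum>j\<in>J. conjugate (f j) (\<xi> j)) \<le> (\<Sum>j\<in>J. ereal (t j))"
      by (intro sum_mono *(1))
    then show ?thesis using *(2,3) by auto
  qed
  show ?lhs if ?rhs
  proof -
    obtain \<xi> where *: "\<phi> = (\<Sum>j\<in>J. \<xi> j)" "(\<Sum>j\<in>J. conjugate (f j) (\<xi> j)) \<le> ereal s"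
      using \<open>?rhs\<close> by blast
    define t where "t = (\<lambda>j. real_of_ereal (conjugate (f j) (\<xi> j)))"
    have "(\<Sum>j\<in>J. conjugate (f j) (\<xi> j)) \<noteq> \<infinity>" using *(2) by auto
    then have t: "conjugate (f j) (\<xi> j) = ereal (t j)" if "j \<in> J" for j
      using that fin conjugate_neq_MInfty[OF proper[OF that], of "\<xi> j"]
      by (auto simp: sum_Pinfty t_def ereal_real)
    then have "ereal (\<Sum>j\<in>J. t j) \<le> ereal s" using *(2) by simp
    moreover have "(\<phi>, \<Sum>j\<in>J. t j) \<in> (\<Sum>j\<in>J. epi (conjugate (f j)))"
      unfolding mem_sum_epi_conjugate_iff[OF fin] using *(1) t
      by (intro exI[of _ \<xi>] exI[of _ t]) simp
    ultimately show ?thesis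
      using sum_epi_conjugate_upward[OF J] by simp
  qed
qed

text \<open>Summing affine minorants gives one direction. For the other, Fenchel--Moreau yields for
  each summand a minorant above any prescribed smaller value at \<open>x\<close>, and the sum of
  these belongs to the epigraph sum.\<close>

lemma robust_sum_le_iff:
  fixes f :: "'i \<Rightarrow> 'a::lctvs \<Rightarrow> ereal"
  assumes f: "\<And>i. i \<in> I \<Longrightarrow> f i \<in> proper_lsc_convex"
  shows "robust_sum I f x \<le> ereal r \<longleftrightarrow>
    (\<forall>p\<in>(\<Union>J\<in>fin_subsets I. \<Sum>j\<in>J. epi (conjugate (f j))). dual_apply (fst p) x - snd p \<le> r)"
    (is "?lhs \<longleftrightarrow> ?rhs")
proof
  assume ?lhs
  show ?rhs
  proof
    fix p assume "p \<in> (\<Union>J\<in>fin_subsets I. \<Sum>j\<in>J. epi (conjugate (f j)))"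
    then obtain J where J: "J \<in> fin_subsets I" "(fst p, snd p) \<in> (\<Sum>j\<in>J. epi (conjugate (f j)))"
      by auto
    then have fin: "finite J" by (simp add: fin_subsets_def)
    obtain \<xi> t where *: "\<And>j. j \<in> J \<Longrightarrow> conjugate (f j) (\<xi> j) \<le> ereal (t j)"
        "fst p = (\<Sum>j\<in>J. \<xi> j)" "snd p = (\<Sum>j\<in>J. t j)"
      using J(2) unfolding mem_sum_epi_conjugate_iff[OF fin] by blast
    have "ereal (dual_apply (fst p) x - snd p) = (\<Sum>j\<in>J. ereal (dual_apply (\<xi> j) x - t j))"
      by (simp add: *(2,3) sum_subtractf)
    also have "\<dots> \<le> (\<Sum>j\<in>J. f j x)"
      using *(1) by (intro sum_mono) (simp add: conjugate_le_iff)
    also have "\<dots> \<le> robust_sum I f x"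
      unfolding robust_sum_def using J(1) by (intro SUP_upper)
    also note \<open>?lhs\<close>
    finally show "dual_apply (fst p) x - snd p \<le> r" by simp
  qed
next
  assume R: ?rhs
  show ?lhs
    unfolding robust_sum_def
  proof (rule SUP_least)
    fix J assume J: "J \<in> fin_subsets I"
    then have fin: "finite J" and JI: "J \<subseteq> I" by (auto simp: fin_subsets_def)
    show "(\<Sum>j\<in>J. f j x) \<le> ereal r"
    proof (rule ereal_sum_le_real[OF fin])
      show "f j x \<noteq> -\<infinity>" if "j \<in> J" for j
        using f[of j] JI that by (auto simp: proper_lsc_convex_def proper_def)
      fix a assume a: "\<And>j. j \<in> J \<Longrightarrow> ereal (a j) < f j x"
      have "\<exists>\<phi> s. conjugate (f j) \<phi> \<le> ereal s \<and> a j < dual_apply \<phi> x - s" if "j \<in> J" for j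
        using Fenchel_Moreau[OF f a[OF that]] JI that by blast
      then obtain \<xi> t where \<xi>: "\<And>j. j \<in> J \<Longrightarrow> conjugate (f j) (\<xi> j) \<le> ereal (t j)"
          "\<And>j. j \<in> J \<Longrightarrow> a j < dual_apply (\<xi> j) x - t j" by metis
      have "(\<Sum>j\<in>J. a j) \<le> (\<Sum>j\<in>J. dual_apply (\<xi> j) x - t j)"
        using \<xi>(2) by (intro sum_mono less_imp_le)
      also have "\<dots> = dual_apply (\<Sum>j\<in>J. \<xi> j) x - (\<Sum>j\<in>J. t j)"
        by (simp add: sum_subtractf)
      also have "\<dots> \<le> r"
      proof -
        have "(\<Sum>j\<in>J. \<xi> j, \<Sum>j\<in>J. t j) \<in> (\<Sum>j\<in>J. epi (conjugate (f j)))"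
          unfolding mem_sum_epi_conjugate_iff[OF fin] using \<xi>(1) by blast
        then show ?thesis using R J by fastforce
      qed
      finally show "(\<Sum>j\<in>J. a j) \<le> r" .
    qed
  qed
qed

lemma pos_sum_eq_robust_sum:
  assumes inconsistent: "\<not> (\<exists>x. \<forall>i\<in>I. f i x \<le> 0)"
  shows "pos_sum I f x = robust_sum I f x"
proof (rule antisym)
  obtain k where k: "k \<in> I" "0 < f k x" using inconsistent not_le by blast
  show "pos_sum I f x \<le> robust_sum I f x"
    unfolding pos_sum_eq_SUP
  proof (rule SUP_least)
    fix J assume "J \<in> {J. finite J \<and> J \<subseteq> I}"
    then have J: "finite J" "J \<subseteq> I" by auto
    \<comment> \<open>Dropping the nonpositive terms leaves the positive parts; the index
      \<open>k\<close> from inconsistency keeps the set nonempty, as the robust sum demands.\<close>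
    define J' where "J' = {i \<in> insert k J. 0 < f i x}"
    have J': "J' \<in> fin_subsets I" using J k by (auto simp: fin_subsets_def J'_def)
    have "(\<Sum>i\<in>J. max (f i x) 0) \<le> (\<Sum>i\<in>insert k J. max (f i x) 0)"
      using J by (intro sum_mono2) auto
    also have "\<dots> = (\<Sum>i\<in>J'. max (f i x) 0)"
      using J by (intro sum.mono_neutral_right) (auto simp: J'_def max_def)
    also have "\<dots> = (\<Sum>i\<in>J'. f i x)"
      by (intro sum.cong) (auto simp: J'_def max_def)
    also have "\<dots> \<le> robust_sum I f x"
      unfolding robust_sum_def using J' by (intro SUP_upper)
    finally show "(\<Sum>i\<in>J. max (f i x) 0) \<le> robust_sum I f x" .
  qed
  show "robust_sum I f x \<le> pos_sum I f x"
    unfolding pos_sum_eq_SUP robust_sum_def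
    by (rule SUP_mono) (auto simp: fin_subsets_def intro!: sum_mono)
qed

section \<open>Minimizers and duality for the sum of positive parts\<close>

theorem proposition6p2:
  fixes f :: "'i \<Rightarrow> 'a::lctvs \<Rightarrow> ereal" and I :: "'i set"
  assumes "infinite I"
    and "\<And>i. i \<in> I \<Longrightarrow> f i \<in> proper_lsc_convex"
    and inconsistent: "\<not> (\<exists>x. \<forall>i\<in>I. f i x \<le> 0)"
    and "proper (robust_sum I f)"
    and "weakly_inf_locally_compact (robust_sum I f)"
    and "subspace (closed_cone (convex hull
           (\<Union>J\<in>fin_subsets I. \<Sum>j\<in>J. eff_dom (conjugate (f j)))))"
  shows "(\<exists>K L. K \<noteq> {} \<and> convex K \<and> compactin weak_topology K \<and> fin_dim_subspace L \<and>
            l1_sol I f = K + L) \<and>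
         (is_maximum (INF x. pos_sum I f x)
            {- (\<Sum>j\<in>J. conjugate (f j) (\<xi> j)) | J \<xi>.
               J \<in> fin_subsets I \<and> (\<Sum>j\<in>J. \<xi> j) = 0}
          \<longleftrightarrow>
          closed_convex_regarding (\<Union>J\<in>fin_subsets I. \<Sum>j\<in>J. epi (conjugate (f j)))
            ({0} \<times> UNIV))"
proof -
  define h where "h = robust_sum I f"
  define C where "C = (\<Union>J\<in>fin_subsets I. \<Sum>j\<in>J. epi (conjugate (f j)))"
  have pos: "pos_sum I f = h"
    unfolding h_def by (intro ext pos_sum_eq_robust_sum inconsistent)
  have level: "h x \<le> ereal r \<longleftrightarrow> (\<forall>p\<in>C. dual_apply (fst p) x - snd p \<le> r)" for x r
    unfolding h_def C_def by (intro robust_sum_le_iff assms(2))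
  have fst_C: "fst ` C = (\<Union>J\<in>fin_subsets I. \<Sum>j\<in>J. eff_dom (conjugate (f j)))"
    unfolding C_def image_UN
    by (intro SUP_cong fst_image_sum_epi_conjugate) (auto simp: fin_subsets_def)
  \<comment> \<open>Nonnegativity is read off the positive parts and finiteness of the infimum off
    properness, so the infimum is a real number \<open>m\<close>.\<close>
  have "0 \<le> h x" for x
    unfolding pos[symmetric] pos_sum_def by (intro infsum_nonneg) simp
  then have "0 \<le> (INF x. h x)" by (intro INF_greatest)
  moreover have "(INF x. h x) \<noteq> \<infinity>"
    using assms(4) INF_lower[OF UNIV_I, of h]
    by (metis ereal_infty_less_eq(1) h_def proper_def)
  ultimately obtain m where m: "(INF x. h x) = ereal m"
    by (cases "INF x. h x") auto
  have up: "(\<phi>, t) \<in> C" if mem: "(\<phi>, s) \<in> C" and le: "s \<le> t" for \<phi> s t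
  proof -
    obtain J where J: "J \<in> fin_subsets I" "(\<phi>, s) \<in> (\<Sum>j\<in>J. epi (conjugate (f j)))"
      using mem by (auto simp: C_def)
    then show ?thesis
      using sum_epi_conjugate_upward[OF J le] by (auto simp: C_def)
  qed
  have ne: "C \<noteq> {}"
  proof
    assume "C = {}"
    then have "h 0 \<le> ereal (m - 1)" by (simp add: level)
    then show False using sup_affine_ge_inf[OF level m] by fastforce
  qed
  have sol: "l1_sol I f = {x. h x \<le> ereal m}"
    unfolding l1_sol_def pos m[symmetric] by (auto simp: le_INF_iff)
  have closure_ge: "- m \<le> s" if "(0, s) \<in> closure (convex hull C)" for s
  proof (rule ccontr)
    assume "\<not> - m \<le> s"
    \<comment> \<open>The level is the midpoint of \<open>m\<close> and \<open>- s\<close>; a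
      minorant through \<open>(0, s)\<close> would have the constant value \<open>- s\<close> above
      it.\<close>
    then obtain x where "h x \<le> ereal ((m - s) / 2)"
      using sup_affine_level_nonempty[OF level m, of "(m - s) / 2"] by auto
    from closure_hull_minorant[OF level m that this] \<open>\<not> - m \<le> s\<close> show False
      by simp
  qed
  have closure_mem: "(0, - m) \<in> closure (convex hull C)"
    by (rule neg_inf_mem_closure_hull[OF level m ne up])
  have hull: "C \<subseteq> closure (convex hull C)"
    by (rule order_trans[OF hull_subset closure_subset])
  have mem: "(0, s) \<in> C \<longleftrightarrow> (\<exists>J \<xi>. J \<in> fin_subsets I \<and> (\<Sum>j\<in>J. \<xi> j) = 0 \<and>
      (\<Sum>j\<in>J. conjugate (f j) (\<xi> j)) \<le> ereal s)" for s
  proof -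
    have *: "(0, s) \<in> (\<Sum>j\<in>J. epi (conjugate (f j))) \<longleftrightarrow>
        (\<exists>\<xi>. (\<Sum>j\<in>J. \<xi> j) = 0 \<and> (\<Sum>j\<in>J. conjugate (f j) (\<xi> j)) \<le> ereal s)"
      if "J \<in> fin_subsets I" for J
      using that assms(2)
      by (intro sum_conjugate_le_iff) (auto simp: fin_subsets_def proper_lsc_convex_def)
    show ?thesis
      unfolding C_def UN_iff Bex_def by (simp add: * cong: conj_cong)
  qed
  \<comment> \<open>On the vertical axis the closed hull has no point below \<open>(0, - m)\<close>,
    which it contains. As \<open>C\<close> is closed upwards, its slice agrees with that of the hull
    exactly when it contains this lowest point.\<close>
  have regarding: "closed_convex_regarding C ({0} \<times> UNIV) \<longleftrightarrow> (0, - m) \<in> C"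
    unfolding closed_convex_regarding_def
    using closure_mem closure_ge hull up[of 0 "- m"] by auto
  have neg: "c \<le> ereal (- r) \<longleftrightarrow> ereal r \<le> - c" for c r
    by (cases c) auto
  have "is_maximum (ereal m) {- (\<Sum>j\<in>J. conjugate (f j) (\<xi> j)) | J \<xi>.
      J \<in> fin_subsets I \<and> (\<Sum>j\<in>J. \<xi> j) = 0} \<longleftrightarrow> (0, - m) \<in> C" (is "is_maximum _ ?S \<longleftrightarrow> _")
  proof
    assume "is_maximum (ereal m) ?S"
    then obtain J \<xi> where J: "J \<in> fin_subsets I" "(\<Sum>j\<in>J. \<xi> j) = 0"
      "ereal m = - (\<Sum>j\<in>J. conjugate (f j) (\<xi> j))" by (auto simp: is_maximum_def)
    then have "(\<Sum>j\<in>J. conjugate (f j) (\<xi> j)) \<le> ereal (- m)"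
      by (simp add: neg)
    then show "(0, - m) \<in> C" unfolding mem using J by blast
  next
    assume "(0, - m) \<in> C"
    then obtain J \<xi> where J: "J \<in> fin_subsets I" "(\<Sum>j\<in>J. \<xi> j) = 0"
      "(\<Sum>j\<in>J. conjugate (f j) (\<xi> j)) \<le> ereal (- m)" by (auto simp: mem)
    \<comment> \<open>Weak duality: a dual value above \<open>m\<close> would place a point of
      \<open>C\<close> below \<open>(0, - m)\<close> on the axis.\<close>
    have weak: "v \<le> ereal m" if v: "v \<in> ?S" for v
    proof (rule ccontr)
      assume "\<not> v \<le> ereal m"
      then obtain r where r: "ereal m < ereal r" "ereal r < v" using ereal_dense2 by (metis not_le)
      obtain J \<xi> where J: "J \<in> fin_subsets I" "(\<Sum>j\<in>J. \<xi> j) = 0"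
        "v = - (\<Sum>j\<in>J. conjugate (f j) (\<xi> j))" using v by blast
      then have "(\<Sum>j\<in>J. conjugate (f j) (\<xi> j)) \<le> ereal (- r)"
        using r(2) by (simp add: neg less_imp_le)
      then have "(0, - r) \<in> C" unfolding mem using J by blast
      then have "- m \<le> - r" using closure_ge hull by blast
      then show False using r(1) by simp
    qed
    have S: "- (\<Sum>j\<in>J. conjugate (f j) (\<xi> j)) \<in> ?S" using J by blast
    have "ereal m \<le> - (\<Sum>j\<in>J. conjugate (f j) (\<xi> j))"
      using J(3) by (simp only: neg)
    then have "ereal m = - (\<Sum>j\<in>J. conjugate (f j) (\<xi> j))"
      using weak[OF S] by (rule antisym)
    then show "is_maximum (ereal m) ?S" using S weak by (simp add: is_maximum_def)
  qed
  moreover have "\<exists>K L. K \<noteq> {} \<and> convex K \<and> compactin weak_topology K \<and> fin_dim_subspace L \<and>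
      l1_sol I f = K + L"
    unfolding sol using argmin_decomposition[OF level m] assms(5,6) by (simp add: h_def fst_C)
  ultimately show ?thesis
    using regarding unfolding pos m C_def[symmetric] by blast
qed

end
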